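(* For every $f\in C^1_b(\mathbb{R}^d)$, every $p\in(1,+\infty)$ and every $s\in I$, $$\int_{\mathbb{R}^d}|f|^p\log(|f|)\,\mu_s(dx)\le \frac1p\, m_s(|f|^p)\log\big(m_s(|f|^p)\big)+\frac{p\Lambda}{2|r_0|}\int_{\mathbb{R}^d}|f|^{p-2}|\nabla f|^2\chi_{\{f\neq 0\}}\,\mu_s(dx).$$
   Context: Let $I$ be an open right halfline. For $t\in I$ let $(\mathcal{A}(t)\zeta)(x)=\mathrm{Tr}(Q(t)D^2\zeta(x))+\langle b(t,x),\nabla\zeta(x)\rangle$, $x\in\mathbb{R}^d$, where $Q=[q_{ij}]_{i,j=1,\dots,d}$ depends only on $t$, $b=(b_1,\dots,b_d)$, and the following hypotheses hold. (i) For some $\alpha\in(0,1)$, $q_{ij}\in C^{\alpha/2}_{\rm loc}(I)$ and $b_i\in C^{\alpha/2,\alpha}_{\rm loc}(I\times\mathbb{R}^d)$ (parabolic Hölder continuity on compact sets: exponent $\alpha/2$ in time and $\alpha$ in space). (ii) For every $t\in I$ the matrix $Q(t)$ is symmetric and there are constants $0<\eta_0<\Lambda$ with $\eta_0|\xi|^2\le\langle Q(t)\xi,\xi\rangle\le\Lambda|\xi|^2$ for all $(t,\xi)\in I\times\mathbb{R}^d$. (iii) There are $\varphi\in C^2(\mathbb{R}^d)$ with positive values and constants $a,c>0$ such that $\lim_{|x|\to+\infty}\varphi(x)=+\infty$ and $(\mathcal{A}(t)\varphi)(x)\le a-c\varphi(x)$ for all $(t,x)\in I\times\mathbb{R}^d$.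 (iv) The first order spatial derivatives of each $b_i$ exist and belong to $C^{\alpha/2,\alpha}_{\rm loc}(I\times\mathbb{R}^d)$, and there is $r_0<0$ such that $\langle\nabla_xb(t,x)\xi,\xi\rangle\le r_0|\xi|^2$ for all $(t,x)\in I\times\mathbb{R}^d$, $\xi\in\mathbb{R}^d$. $C_b(\mathbb{R}^d)$ is the space of bounded continuous real functions, and $C^1_b(\mathbb{R}^d)$ the space of bounded $C^1$ functions with bounded first order derivatives. For $f\in C_b(\mathbb{R}^d)$ and $s\in I$, $(t,x)\mapsto(G(t,s)f)(x)$ denotes the unique bounded classical solution (in $C_b([s,+\infty)\times\mathbb{R}^d)\cap C^{1,2}((s,+\infty)\times\mathbb{R}^d)$) of $D_tu=\mathcal{A}(t)u$ for $t>s$, $u(s,\cdot)=f$. An evolution system of measures for $G(t,s)$ is a family $\{\mu_t:t\in I\}$ of Borel probability measures on $\mathbb{R}^d$ with $\int_{\mathbb{R}^d}G(t,s)f\,d\mu_t=\int_{\mathbb{R}^d}f\,d\mu_s$ for all $t>s$ in $I$ and $f\in C_b(\mathbb{R}^d)$. It is tight if for every $\varepsilon>0$ there is $R>0$ with $\mu_t(\mathbb{R}^d\setminus B(0,R))\le\varepsilon$ for all $t\in I$. Under these hypotheses there is a unique tight evolution system of measures, denoted $\{\mu_t:t\in I\}$; it satisfies $\sup_{t\in I}\int\varphi\,d\mu_t<+\infty$. Notation: $m_s(f)=\int_{\mathbb{R}^d}f\,d\mu_s$; $\chi_A$ is the characteristic function of $A$; convention $0\log0=0$. *)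

theory Defs
  imports "HOL-Probability.Probability"
begin

definition grad :: "(real^'n \<Rightarrow> real) \<Rightarrow> real^'n \<Rightarrow> real^'n" where
  "grad f x = (\<chi> i. frechet_derivative f (at x) (axis i 1))"

definition hessian :: "(real^'n \<Rightarrow> real) \<Rightarrow> real^'n \<Rightarrow> real^'n^'n" where
  "hessian f x = jacobian (grad f) (at x)"

definition C1 :: "(real^'n \<Rightarrow> real) \<Rightarrow> bool" where
  "C1 f \<longleftrightarrow> (\<forall>x. f differentiable (at x)) \<and> continuous_on UNIV (grad f)"

definition C2 :: "(real^'n \<Rightarrow> real) \<Rightarrow> bool" where
  "C2 f \<longleftrightarrow> C1 f \<and> (\<forall>x. grad f differentiable (at x)) \<and> continuous_on UNIV (hessian f)"

definition Cb :: "(real^'n \<Rightarrow> real) set" where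
  "Cb = {f. continuous_on UNIV f \<and> bounded (range f)}"

definition Cb1 :: "(real^'n \<Rightarrow> real) set" where
  "Cb1 = {f. C1 f \<and> bounded (range f) \<and> bounded (range (grad f))}"

definition holder_loc :: "real \<Rightarrow> real set \<Rightarrow> (real \<Rightarrow> real) \<Rightarrow> bool" where
  "holder_loc \<beta> I q \<longleftrightarrow>
    (\<forall>K. compact K \<and> K \<subseteq> I \<longrightarrow>
      (\<exists>C. \<forall>t\<in>K. \<forall>r\<in>K. \<bar>q t - q r\<bar> \<le> C * \<bar>t - r\<bar> powr \<beta>))"

text \<open>The class \<open>C\<^sup>\<alpha>\<^sup>/\<^sup>2\<^sup>,\<^sup>\<alpha>\<close> on compact subsets of \<open>I \<times> \<real>\<^sup>d\<close>.\<close>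

definition parabolic_holder_loc :: "real \<Rightarrow> real set \<Rightarrow> (real \<Rightarrow> real^'n \<Rightarrow> real) \<Rightarrow> bool" where
  "parabolic_holder_loc \<alpha> I g \<longleftrightarrow>
    (\<forall>K. compact K \<and> K \<subseteq> I \<times> UNIV \<longrightarrow>
      (\<exists>C. \<forall>(t, x)\<in>K. \<forall>(r, y)\<in>K.
        \<bar>g t x - g r y\<bar> \<le> C * (\<bar>t - r\<bar> powr (\<alpha> / 2) + norm (x - y) powr \<alpha>)))"

definition kolmogorov_op ::
    "(real \<Rightarrow> real^'n^'n) \<Rightarrow> (real \<Rightarrow> real^'n \<Rightarrow> real^'n) \<Rightarrow> real \<Rightarrow> (real^'n \<Rightarrow> real) \<Rightarrow> real^'n \<Rightarrow> real"
  where
  "kolmogorov_op Q b t \<zeta> x = trace (Q t ** hessian \<zeta> x) + b t x \<bullet> grad \<zeta> x"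

text \<open>\<open>C\<^sup>1\<^sup>,\<^sup>2((s,+\<infinity>) \<times> \<real>\<^sup>d)\<close>: one time derivative and two space derivatives, all jointly continuous.\<close>

definition C12 :: "real \<Rightarrow> (real \<Rightarrow> real^'n \<Rightarrow> real) \<Rightarrow> bool" where
  "C12 s u \<longleftrightarrow>
    (\<forall>t>s. \<forall>x. (\<lambda>\<tau>. u \<tau> x) differentiable (at t) \<and>
                u t differentiable (at x) \<and> grad (u t) differentiable (at x)) \<and>
    continuous_on ({s<..} \<times> UNIV) (\<lambda>(t, x). u t x) \<and>
    continuous_on ({s<..} \<times> UNIV) (\<lambda>(t, x). deriv (\<lambda>\<tau>. u \<tau> x) t) \<and>
    continuous_on ({s<..} \<times> UNIV) (\<lambda>(t, x). grad (u t) x) \<and>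
    continuous_on ({s<..} \<times> UNIV) (\<lambda>(t, x). hessian (u t) x)"

definition bounded_classical_solution ::
    "(real \<Rightarrow> real^'n^'n) \<Rightarrow> (real \<Rightarrow> real^'n \<Rightarrow> real^'n) \<Rightarrow> real \<Rightarrow> (real^'n \<Rightarrow> real)
      \<Rightarrow> (real \<Rightarrow> real^'n \<Rightarrow> real) \<Rightarrow> bool" where
  "bounded_classical_solution Q b s f u \<longleftrightarrow>
    continuous_on ({s..} \<times> UNIV) (\<lambda>(t, x). u t x) \<and>
    bounded ((\<lambda>(t, x). u t x) ` ({s..} \<times> UNIV)) \<and>
    C12 s u \<and>
    (\<forall>t>s. \<forall>x. deriv (\<lambda>\<tau>. u \<tau> x) t = kolmogorov_op Q b t (u t) x) \<and>
    (\<forall>x. u s x = f x)"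

text \<open>
  \<open>G t s f x\<close> stands for \<open>(G(t,s)f)(x)\<close>; this determines \<open>G\<close> for \<open>s \<in> I\<close>, \<open>t \<ge> s\<close> and
  \<open>f \<in> Cb\<close>, as the bounded classical solution is unique under the hypotheses in force wherever
  the predicate is used. Other values of \<open>G\<close> are irrelevant.
\<close>

definition evolution_operator ::
    "real set \<Rightarrow> (real \<Rightarrow> real^'n^'n) \<Rightarrow> (real \<Rightarrow> real^'n \<Rightarrow> real^'n)
      \<Rightarrow> (real \<Rightarrow> real \<Rightarrow> (real^'n \<Rightarrow> real) \<Rightarrow> real^'n \<Rightarrow> real) \<Rightarrow> bool" where
  "evolution_operator I Q b G \<longleftrightarrow>
    (\<forall>s\<in>I. \<forall>f\<in>Cb. bounded_classical_solution Q b s f (\<lambda>t. G t s f))"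

definition evolution_system_of_measures ::
    "real set \<Rightarrow> (real \<Rightarrow> real \<Rightarrow> (real^'n \<Rightarrow> real) \<Rightarrow> real^'n \<Rightarrow> real)
      \<Rightarrow> (real \<Rightarrow> (real^'n) measure) \<Rightarrow> bool" where
  "evolution_system_of_measures I G \<mu> \<longleftrightarrow>
    (\<forall>t\<in>I. prob_space (\<mu> t) \<and> sets (\<mu> t) = sets borel) \<and>
    (\<forall>s\<in>I. \<forall>t\<in>I. s < t \<longrightarrow> (\<forall>f\<in>Cb. (\<integral>x. G t s f x \<partial>\<mu> t) = (\<integral>x. f x \<partial>\<mu> s)))"

definition tight_family :: "real set \<Rightarrow> (real \<Rightarrow> (real^'n) measure) \<Rightarrow> bool" where
  "tight_family I \<mu> \<longleftrightarrow>
    (\<forall>\<epsilon>>0. \<exists>R>0. \<forall>t\<in>I. measure (\<mu> t) (- ball 0 R) \<le> \<epsilon>)"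

end

theory Submission
  imports Defs
begin

text \<open>
  The inequality is the logarithmic Sobolev inequality for \<open>h = \<bar>f\<bar> powr p\<close>: since
  \<open>\<bar>\<nabla>h\<bar>\<^sup>2 / h = p\<^sup>2 \<bar>f\<bar> powr (p - 2) \<bar>\<nabla>f\<bar>\<^sup>2\<close> where \<open>f \<noteq> 0\<close>, it reads
  \<open>\<integral> h ln h d\<mu>\<^sub>s \<le> m ln m + \<Lambda> / (2\<bar>r\<^sub>0\<bar>) \<integral> \<bar>\<nabla>h\<bar>\<^sup>2 / h d\<mu>\<^sub>s\<close> with \<open>m = \<integral> h d\<mu>\<^sub>s\<close>, after
  multiplication by \<open>p\<close>. It is proved for \<open>h \<ge> \<delta> > 0\<close> and then applied to
  \<open>\<delta> + \<bar>f\<bar> powr p\<close> as \<open>\<delta> \<rightarrow> 0\<close>.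
  
  Everything rests on comparison of classical sub- and supersolutions, so that no regularity of
  \<open>G(t,s)f\<close> beyond \<open>C\<^sup>1\<^sup>,\<^sup>2\<close> and no differentiation under an integral with respect to
  \<open>\<mu>\<^sub>t\<close> occurs. Write \<open>u = G(t,s)h\<close> and \<open>w = G(t,s)(\<bar>\<nabla>h\<bar>\<^sup>2 / h)\<close>.
  
  \<^item> The gradient estimate \<open>\<bar>\<nabla>u\<bar>\<^sup>2 \<le> exp (2 r\<^sub>0 (t - s)) w u\<close> (\<open>gradient_estimate\<close>) comes from
  doubling the variables (\<open>doubling_estimate\<close>). As \<open>Q\<close> does not depend on \<open>x\<close>, the operator that
  moves both points \<open>x\<close> and \<open>y\<close> with the same noise sees \<open>\<bar>x - y\<bar>\<close> only through the drift,
  which contracts it at rate \<open>\<bar>r\<^sub>0\<bar>\<close>. Hence \<open>exp (r\<^sub>0 (t - s)) \<bar>x - y\<bar> v(t,x)\<close> is a supersolution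
  in the doubled variables whenever \<open>v \<ge> 0\<close> is one in \<open>x\<close>, and it dominates
  \<open>u(t,x) - u(t,y)\<close> if it does so at time \<open>s\<close>, up to a term quadratic in \<open>\<bar>x - y\<bar>\<close>. By Young's
  inequality \<open>v = w / (2\<kappa>) + \<kappa> u / 2\<close> majorises \<open>\<bar>\<nabla>h\<bar>\<close> at time \<open>s\<close> for every
  \<open>\<kappa> > 0\<close>; letting \<open>y \<rightarrow> x\<close> and optimising in \<open>\<kappa>\<close> gives the estimate.
  
  \<^item> With \<open>k' = \<Lambda> exp (2 r\<^sub>0 (t - s))\<close>, \<open>k(s) = 0\<close>, the function \<open>u ln u + k(t) w\<close> is a
  supersolution, because the defect \<open>\<langle>Q \<nabla>u, \<nabla>u\<rangle> / u\<close> of \<open>u ln u\<close> is at most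
  \<open>k'(t) w\<close>. It starts from \<open>h ln h\<close>, so it dominates \<open>G(t,s)(h ln h)\<close>
  (\<open>local_log_Sobolev\<close>), and \<open>k \<le> \<Lambda> / (2\<bar>r\<^sub>0\<bar>)\<close>.
  
  \<^item> Integrating against \<open>\<mu>\<^sub>t\<close> turns \<open>G(t,s)(h ln h)\<close> and \<open>w\<close> into integrals against
  \<open>\<mu>\<^sub>s\<close>. As \<open>t \<rightarrow> \<infinity>\<close> the gradient of \<open>u\<close> tends to zero uniformly, and tightness shows that
  \<open>u\<close> concentrates at its mean \<open>m\<close>, so \<open>\<integral> u ln u d\<mu>\<^sub>t\<close> is in the limit at most
  \<open>m ln m\<close> (\<open>log_Sobolev_bounded_below\<close>).
\<close>

section \<open>Traces of products of matrices\<close>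

definition outer :: "real^'n \<Rightarrow> real^'n^'n" where
  "outer v = (\<chi> i j. v $ i * v $ j)"

lemma outer_mult: "outer v *v w = (v \<bullet> w) *\<^sub>R v"
  by (simp add: vec_eq_iff outer_def matrix_vector_mult_def inner_vec_def sum_distrib_left
      sum_distrib_right mult_ac)

lemma trace_mult_outer: "trace (A ** outer v) = (A *v v) \<bullet> v"
  by (simp add: trace_def outer_def matrix_matrix_mult_def matrix_vector_mult_def inner_vec_def
      sum_distrib_left sum_distrib_right mult_ac)

lemma trace_outer_mult: "trace (outer v ** A) = (A *v v) \<bullet> v"
  by (subst trace_mul_sym) (rule trace_mult_outer)

lemma trace_matrix_add_right: "trace (A ** (B + C)) = trace (A ** B) + trace (A ** (C :: real^'n^'n))"
  by (simp add: matrix_add_ldistrib trace_add)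

lemma trace_matrix_diff_right: "trace (A ** (B - C)) = trace (A ** B) - trace (A ** (C :: real^'n^'n))"
  by (simp add: matrix_matrix_mult_def trace_def algebra_simps sum_subtractf)

lemma trace_matrix_minus_right: "trace (A ** (- B)) = - trace (A ** (B :: real^'n^'n))"
  by (simp add: matrix_matrix_mult_def trace_def sum_negf)

lemma trace_matrix_scaleR_right: "trace (A ** (k *\<^sub>R B)) = k * trace (A ** (B :: real^'n^'n))"
  by (simp add: matrix_matrix_mult_def trace_def sum_distrib_left mult_ac)

lemmas trace_right_linear = trace_matrix_add_right trace_matrix_diff_right
  trace_matrix_minus_right trace_matrix_scaleR_right

text \<open>
  Symmetric Gaussian elimination: splitting off the rank-one matrix \<open>v v\<^sup>T / Q\<^sub>k\<^sub>k\<close> of a row \<open>v\<close>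
  leaves a positive semidefinite matrix with one zero row more, and a rank-one term contributes the
  value of the quadratic form of \<open>H\<close> at \<open>v\<close>, up to a nonnegative factor. The set \<open>S\<close> contains the indices of the rows
  not yet eliminated.
\<close>

lemma trace_psd_nsd_nonpos_aux:
  fixes Q H :: "real^'n^'n"
  assumes "finite S"
    and "transpose Q = Q" "\<And>\<xi>. 0 \<le> (Q *v \<xi>) \<bullet> \<xi>" "\<And>i j. i \<notin> S \<Longrightarrow> Q $ i $ j = 0"
    and H: "\<And>\<xi>. (H *v \<xi>) \<bullet> \<xi> \<le> 0"
  shows "trace (Q ** H) \<le> 0"
  using assms(1-4)
proof (induction S arbitrary: Q rule: finite_induct)
  case empty
  then have "Q = 0" by (simp add: vec_eq_iff)
  then show ?case by (simp add: trace_def)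
next
  case (insert k S)
  have sym: "Q $ i $ j = Q $ j $ i" for i j
    using insert.prems(1) by (metis transpose_def vec_lambda_beta)
  define v where "v = Q $ k"
  define q where "q = Q $ k $ k"
  have col: "Q *v axis k 1 = v"
    by (simp add: matrix_vector_mult_basis column_def v_def vec_eq_iff sym)
  have "(Q *v \<xi>) \<bullet> axis k 1 = v \<bullet> \<xi>" for \<xi>
    by (simp add: inner_axis matrix_vector_mul_component v_def)
  with col have Qv: "(Q *v axis k 1) \<bullet> \<xi> = v \<bullet> \<xi>" "(Q *v \<xi>) \<bullet> axis k 1 = v \<bullet> \<xi>" for \<xi>
    by simp_all
  have vk: "v \<bullet> axis k 1 = q" by (simp add: v_def q_def inner_axis)
  have quad: "0 \<le> (Q *v \<xi>) \<bullet> \<xi> + 2 * r * (v \<bullet> \<xi>) + r\<^sup>2 * q" for \<xi> r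
  proof -
    have "0 \<le> (Q *v (\<xi> + r *\<^sub>R axis k 1)) \<bullet> (\<xi> + r *\<^sub>R axis k 1)" by (rule insert.prems)
    also have "\<dots> = (Q *v \<xi>) \<bullet> \<xi> + 2 * r * (v \<bullet> \<xi>) + r\<^sup>2 * q"
      by (simp add: matrix_vector_right_distrib matrix_vector_mult_scaleR inner_add_left inner_add_right Qv vk
          power2_eq_square algebra_simps)
    finally show ?thesis .
  qed
  have "q \<ge> 0" using insert.prems(2)[of "axis k 1"] Qv vk by simp
  show ?case
  proof (cases "q = 0")
    case True
    \<comment> \<open>A positive semidefinite form with a zero diagonal entry vanishes on that row:
        for \<open>q = 0\<close> the polynomial in \<open>r\<close> of \<open>quad\<close> is affine, and with nonzero slope it takes
        the value -1.\<close>
    have "v \<bullet> \<xi> = 0" for \<xi>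
    proof (rule ccontr)
      assume n: "v \<bullet> \<xi> \<noteq> 0"
      show False
        using quad[of \<xi> "- ((Q *v \<xi>) \<bullet> \<xi> + 1) / (2 * (v \<bullet> \<xi>))"] True n by (simp add: field_simps)
    qed
    then have "v = 0" by (metis inner_eq_zero_iff)
    then have "Q $ i $ j = 0" if "i \<notin> S" for i j
      using that insert.prems(3)[of i j] by (cases "i = k") (auto simp: v_def)
    then show ?thesis using insert.IH[OF insert.prems(1,2)] by blast
  next
    case False
    with \<open>q \<ge> 0\<close> have q: "q > 0" by simp
    define Q' where "Q' = Q - (1 / q) *\<^sub>R outer v"
    have 1: "transpose Q' = Q'"
      by (simp add: vec_eq_iff transpose_def Q'_def outer_def sym mult.commute)
    have 2: "0 \<le> (Q' *v \<xi>) \<bullet> \<xi>" for \<xi>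
    proof -
      have "(Q' *v \<xi>) \<bullet> \<xi> = (Q *v \<xi>) \<bullet> \<xi> - (v \<bullet> \<xi>)\<^sup>2 / q"
        by (simp add: Q'_def matrix_vector_mult_diff_rdistrib scaleR_matrix_vector_assoc[symmetric]
            outer_mult inner_diff_left power2_eq_square)
      moreover have "0 \<le> (Q *v \<xi>) \<bullet> \<xi> - (v \<bullet> \<xi>)\<^sup>2 / q"
        using quad[of \<xi> "- (v \<bullet> \<xi>) / q"] q by (simp add: power2_eq_square)
      ultimately show ?thesis by simp
    qed
    have 3: "Q' $ i $ j = 0" if "i \<notin> S" for i j
    proof (cases "i = k")
      case True
      then show ?thesis using q by (simp add: Q'_def outer_def v_def q_def)
    next
      case False
      then have "Q $ i $ l = 0" for l using insert.prems(3) that by simp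
      then show ?thesis by (simp add: Q'_def outer_def v_def sym[of k i])
    qed
    have "Q = Q' + (1 / q) *\<^sub>R outer v" by (simp add: Q'_def)
    then have "trace (Q ** H) = trace (Q' ** H) + (1 / q) * trace (outer v ** H)"
      by (metis (no_types) trace_mul_sym trace_right_linear(1,4))
    also have "\<dots> \<le> 0"
      using insert.IH[OF 1 2 3] divide_nonpos_pos[OF H[of v] q] by (simp add: trace_outer_mult)
    finally show ?thesis .
  qed
qed

lemma trace_psd_nsd_nonpos:
  fixes Q H :: "real^'n^'n"
  assumes "transpose Q = Q" "\<And>\<xi>. 0 \<le> (Q *v \<xi>) \<bullet> \<xi>" "\<And>\<xi>. (H *v \<xi>) \<bullet> \<xi> \<le> 0"
  shows "trace (Q ** H) \<le> 0"
  by (rule trace_psd_nsd_nonpos_aux[of UNIV]) (use assms in auto)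

section \<open>Second-order jets along lines\<close>

text \<open>
  The vector \<open>p\<close> and the matrix \<open>H\<close> play the roles of gradient and Hessian of \<open>F\<close> at \<open>x\<close>, but only
  one-variable derivatives along lines through \<open>x\<close> are recorded. This is all that a maximum point
  tests, and it is stable under the operations below. \<open>H\<close> is determined only up to an
  antisymmetric part, which is invisible to the trace against a symmetric matrix.
\<close>

definition jet2 :: "(real^'n \<Rightarrow> real) \<Rightarrow> real^'n \<Rightarrow> real^'n \<Rightarrow> real^'n^'n \<Rightarrow> bool" where
  "jet2 F x p H \<longleftrightarrow> (\<forall>\<sigma>. \<exists>g'.
     (\<forall>r. ((\<lambda>r. F (x + r *\<^sub>R \<sigma>)) has_real_derivative g' r) (at r)) \<and>
     g' 0 = p \<bullet> \<sigma> \<and> (g' has_real_derivative (H *v \<sigma>) \<bullet> \<sigma>) (at 0))"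

lemma jet2_first:
  assumes "jet2 F x p H"
  shows "((\<lambda>r. F (x + r *\<^sub>R \<sigma>)) has_real_derivative p \<bullet> \<sigma>) (at 0)"
proof -
  obtain g' where "\<forall>r. ((\<lambda>r. F (x + r *\<^sub>R \<sigma>)) has_real_derivative g' r) (at r)" "g' 0 = p \<bullet> \<sigma>"
    using assms unfolding jet2_def by blast
  then show ?thesis by metis
qed

lemma jet2_add:
  assumes "jet2 F x p H" "jet2 G x q K"
  shows "jet2 (\<lambda>y. F y + G y) x (p + q) (H + K)"
  unfolding jet2_def
proof
  fix \<sigma>
  obtain f' where f: "\<forall>r. ((\<lambda>r. F (x + r *\<^sub>R \<sigma>)) has_real_derivative f' r) (at r)"
     "f' 0 = p \<bullet> \<sigma>" "(f' has_real_derivative (H *v \<sigma>) \<bullet> \<sigma>) (at 0)"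
    using assms(1) unfolding jet2_def by blast
  obtain g' where g: "\<forall>r. ((\<lambda>r. G (x + r *\<^sub>R \<sigma>)) has_real_derivative g' r) (at r)"
     "g' 0 = q \<bullet> \<sigma>" "(g' has_real_derivative (K *v \<sigma>) \<bullet> \<sigma>) (at 0)"
    using assms(2) unfolding jet2_def by blast
  show "\<exists>h'. (\<forall>r. ((\<lambda>r. F (x + r *\<^sub>R \<sigma>) + G (x + r *\<^sub>R \<sigma>)) has_real_derivative h' r) (at r)) \<and>
     h' 0 = (p + q) \<bullet> \<sigma> \<and> (h' has_real_derivative ((H + K) *v \<sigma>) \<bullet> \<sigma>) (at 0)"
    by (rule exI[of _ "\<lambda>r. f' r + g' r"])
      (use f g in \<open>auto intro!: derivative_eq_intros simp: inner_add_left matrix_vector_mult_add_rdistrib\<close>)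
qed

lemma jet2_scale:
  assumes "jet2 F x p H"
  shows "jet2 (\<lambda>y. k * F y) x (k *\<^sub>R p) (k *\<^sub>R H)"
  unfolding jet2_def
proof
  fix \<sigma>
  obtain f' where f: "\<forall>r. ((\<lambda>r. F (x + r *\<^sub>R \<sigma>)) has_real_derivative f' r) (at r)"
     "f' 0 = p \<bullet> \<sigma>" "(f' has_real_derivative (H *v \<sigma>) \<bullet> \<sigma>) (at 0)"
    using assms(1) unfolding jet2_def by blast
  show "\<exists>h'. (\<forall>r. ((\<lambda>r. k * F (x + r *\<^sub>R \<sigma>)) has_real_derivative h' r) (at r)) \<and>
     h' 0 = (k *\<^sub>R p) \<bullet> \<sigma> \<and> (h' has_real_derivative ((k *\<^sub>R H) *v \<sigma>) \<bullet> \<sigma>) (at 0)"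
    by (rule exI[of _ "\<lambda>r. k * f' r"])
      (use f in \<open>auto intro!: derivative_eq_intros simp: scaleR_matrix_vector_assoc[symmetric]\<close>)
qed

lemma jet2_const: "jet2 (\<lambda>y. k) x 0 0"
  unfolding jet2_def by (rule allI, rule exI[of _ "\<lambda>r. 0"]) (auto intro!: derivative_eq_intros)

lemma jet2_shift:
  assumes "jet2 F (x + e) p H"
  shows "jet2 (\<lambda>y. F (y + e)) x p H"
  using assms unfolding jet2_def by (simp add: add_ac)

text \<open>
  The chain rule \<open>D\<^sup>2(\<psi> \<circ> F) = \<psi>'' \<nabla>F \<nabla>F\<^sup>T + \<psi>' D\<^sup>2F\<close>; its rank-one term is the source of the
  gradient term in the equation satisfied by \<open>u ln u\<close>.
\<close>

lemma jet2_compose: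
  assumes F: "jet2 F x p H"
    and \<psi>: "\<And>y. (\<psi> has_real_derivative \<psi>' (F y)) (at (F y))"
    and \<psi>': "(\<psi>' has_real_derivative c) (at (F x))"
  shows "jet2 (\<lambda>y. \<psi> (F y)) x (\<psi>' (F x) *\<^sub>R p) (c *\<^sub>R outer p + \<psi>' (F x) *\<^sub>R H)"
  unfolding jet2_def
proof
  fix \<sigma>
  obtain f' where f: "\<And>r. ((\<lambda>r. F (x + r *\<^sub>R \<sigma>)) has_real_derivative f' r) (at r)"
     "f' 0 = p \<bullet> \<sigma>" "(f' has_real_derivative (H *v \<sigma>) \<bullet> \<sigma>) (at 0)"
    using F unfolding jet2_def by blast
  have 1: "((\<lambda>r. \<psi> (F (x + r *\<^sub>R \<sigma>))) has_real_derivative \<psi>' (F (x + r *\<^sub>R \<sigma>)) * f' r) (at r)" for r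
    by (rule DERIV_chain2[OF _ f(1)]) (rule \<psi>)
  have "((\<lambda>r. \<psi>' (F (x + r *\<^sub>R \<sigma>))) has_real_derivative c * f' 0) (at 0)"
    by (rule DERIV_chain2[OF _ f(1)]) (use \<psi>' in simp)
  from DERIV_mult[OF this f(3)]
  have 2: "((\<lambda>r. \<psi>' (F (x + r *\<^sub>R \<sigma>)) * f' r) has_real_derivative
      c * (p \<bullet> \<sigma>) * (p \<bullet> \<sigma>) + (H *v \<sigma>) \<bullet> \<sigma> * \<psi>' (F x)) (at 0)"
    by (simp add: f(2))
  show "\<exists>h'. (\<forall>r. ((\<lambda>r. \<psi> (F (x + r *\<^sub>R \<sigma>))) has_real_derivative h' r) (at r)) \<and>
     h' 0 = (\<psi>' (F x) *\<^sub>R p) \<bullet> \<sigma> \<and>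
     (h' has_real_derivative ((c *\<^sub>R outer p + \<psi>' (F x) *\<^sub>R H) *v \<sigma>) \<bullet> \<sigma>) (at 0)"
    by (rule exI[of _ "\<lambda>r. \<psi>' (F (x + r *\<^sub>R \<sigma>)) * f' r"])
      (use 1 2 f(2) in \<open>auto simp: matrix_vector_mult_add_rdistrib inner_add_left outer_mult
        scaleR_matrix_vector_assoc[symmetric] mult_ac\<close>)
qed

lemma frechet_derivative_eq_grad:
  assumes "F differentiable (at x)"
  shows "frechet_derivative F (at x) \<sigma> = grad F x \<bullet> \<sigma>"
proof -
  interpret linear "frechet_derivative F (at x)" by (rule linear_frechet_derivative[OF assms])
  have "frechet_derivative F (at x) \<sigma> = frechet_derivative F (at x) (\<Sum>i\<in>UNIV. \<sigma> $ i *\<^sub>R axis i 1)"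
    by (simp add: basis_expansion flip: scalar_mult_eq_scaleR)
  also have "\<dots> = grad F x \<bullet> \<sigma>"
    by (simp add: sum scale grad_def inner_vec_def mult.commute)
  finally show ?thesis .
qed

lemma grad_eqI:
  assumes "(F has_derivative (\<lambda>\<sigma>. p \<bullet> \<sigma>)) (at x)"
  shows "grad F x = p"
proof -
  have "frechet_derivative F (at x) = (\<lambda>\<sigma>. p \<bullet> \<sigma>)"
    using frechet_derivative_at[OF assms] by simp
  then show ?thesis by (simp add: grad_def vec_eq_iff inner_axis)
qed

lemma has_derivative_grad:
  assumes "F differentiable (at x)"
  shows "(F has_derivative (\<lambda>\<sigma>. grad F x \<bullet> \<sigma>)) (at x)"
proof -
  have "frechet_derivative F (at x) = (\<lambda>\<sigma>. grad F x \<bullet> \<sigma>)"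
    using frechet_derivative_eq_grad[OF assms] by blast
  then show ?thesis using assms by (metis frechet_derivative_works)
qed

lemma has_real_derivative_slice:
  assumes "F differentiable (at (x + r *\<^sub>R \<sigma>))"
  shows "((\<lambda>r. F (x + r *\<^sub>R \<sigma>)) has_real_derivative grad F (x + r *\<^sub>R \<sigma>) \<bullet> \<sigma>) (at r)"
proof -
  have "((\<lambda>r. F (x + r *\<^sub>R \<sigma>)) has_derivative (\<lambda>h. grad F (x + r *\<^sub>R \<sigma>) \<bullet> (h *\<^sub>R \<sigma>))) (at r)"
    by (rule has_derivative_compose[where f = "\<lambda>r. x + r *\<^sub>R \<sigma>" and g = F])
      (auto intro!: derivative_eq_intros has_derivative_grad assms)
  then show ?thesis by (simp add: has_field_derivative_def mult.commute[of _ "grad F (x + r *\<^sub>R \<sigma>) \<bullet> \<sigma>"])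
      
qed

lemma jet2_hessian:
  assumes F: "\<And>y. F differentiable (at y)" and G: "grad F differentiable (at x)"
  shows "jet2 F x (grad F x) (hessian F x)"
  unfolding jet2_def
proof
  fix \<sigma>
  have slice: "((\<lambda>r. x + r *\<^sub>R \<sigma>) has_derivative (\<lambda>h. h *\<^sub>R \<sigma>)) (at 0)"
    by (auto intro!: derivative_eq_intros)
  have "(grad F has_derivative (\<lambda>h. hessian F x *v h)) (at x)"
    unfolding hessian_def by (rule jacobian_works[THEN iffD1, OF G])
  then have "((\<lambda>r. grad F (x + r *\<^sub>R \<sigma>)) has_derivative (\<lambda>h. hessian F x *v (h *\<^sub>R \<sigma>))) (at 0)"
    using has_derivative_compose[where f = "\<lambda>r. x + r *\<^sub>R \<sigma>" and g = "grad F" and x = 0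
        and s = UNIV and f' = "\<lambda>h. h *\<^sub>R \<sigma>" and g' = "\<lambda>h. hessian F x *v h"]
    by (simp add: slice)
  then have "((\<lambda>r. grad F (x + r *\<^sub>R \<sigma>) \<bullet> \<sigma>) has_derivative (\<lambda>h. (hessian F x *v (h *\<^sub>R \<sigma>)) \<bullet> \<sigma>)) (at 0)"
    by (rule has_derivative_inner_left)
  then have "((\<lambda>r. grad F (x + r *\<^sub>R \<sigma>) \<bullet> \<sigma>) has_real_derivative (hessian F x *v \<sigma>) \<bullet> \<sigma>) (at 0)"
    by (simp add: has_field_derivative_def matrix_vector_mult_scaleR mult.commute[of _ "(hessian F x *v \<sigma>) \<bullet> \<sigma>"])
  then show "\<exists>g'. (\<forall>r. ((\<lambda>r. F (x + r *\<^sub>R \<sigma>)) has_real_derivative g' r) (at r)) \<and>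
     g' 0 = grad F x \<bullet> \<sigma> \<and> (g' has_real_derivative (hessian F x *v \<sigma>) \<bullet> \<sigma>) (at 0)"
    using has_real_derivative_slice[OF F] by (intro exI[of _ "\<lambda>r. grad F (x + r *\<^sub>R \<sigma>) \<bullet> \<sigma>"]) auto
qed

lemma DERIV_max_second_nonpos:
  fixes g g' :: "real \<Rightarrow> real"
  assumes g: "\<And>r. (g has_real_derivative g' r) (at r)"
    and D: "(g' has_real_derivative D) (at 0)"
    and max: "\<And>r. g r \<le> g 0"
  shows "g' 0 = 0" "D \<le> 0"
proof -
  show 0: "g' 0 = 0"
    using DERIV_local_max[OF g, of 1 0] max by simp
  show "D \<le> 0"
  proof (rule ccontr)
    assume "\<not> D \<le> 0"
    then obtain d where d: "d > 0" "\<And>h. 0 < h \<Longrightarrow> h < d \<Longrightarrow> g' 0 < g' (0 + h)"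
      using DERIV_pos_inc_right[OF D] by auto
    obtain z where z: "0 < z" "z < d/2" "g (d/2) - g 0 = (d/2 - 0) * g' z"
      using MVT2[of 0 "d/2" g g'] g d(1) by auto
    moreover have "(d/2 - 0) * g' z > 0" using d(2)[of z] z 0 d(1) by simp
    ultimately have "g (d/2) - g 0 > 0" by linarith
    with max[of "d/2"] show False by simp
  qed
qed

lemma jet2_max:
  assumes F: "jet2 F x p H" and max: "\<And>y. F y \<le> F x"
  shows "p = 0" "(H *v \<sigma>) \<bullet> \<sigma> \<le> 0"
proof -
  have *: "p \<bullet> \<sigma> = 0 \<and> (H *v \<sigma>) \<bullet> \<sigma> \<le> 0" for \<sigma>
  proof -
    obtain f' where f: "\<And>r. ((\<lambda>r. F (x + r *\<^sub>R \<sigma>)) has_real_derivative f' r) (at r)"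
       "f' 0 = p \<bullet> \<sigma>" "(f' has_real_derivative (H *v \<sigma>) \<bullet> \<sigma>) (at 0)"
      using F unfolding jet2_def by blast
    from DERIV_max_second_nonpos[OF f(1,3)] max f(2) show ?thesis by simp
  qed
  show "(H *v \<sigma>) \<bullet> \<sigma> \<le> 0" using * by blast
  show "p = 0" using * by (metis inner_eq_zero_iff)
qed

section \<open>Touching points\<close>

text \<open>
  The topological half of the parabolic maximum principle. If \<open>W\<close> becomes nonnegative somewhere, the set
  where it does so lies over a compact set of points, so it has a first time; at that time \<open>W\<close> is still
  nonpositive everywhere by continuity, and it vanishes at some point, which is excluded by
  \<open>touch\<close>.
\<close>

lemma first_touching:
  fixes W :: "real \<Rightarrow> 'a::heine_borel \<Rightarrow> real"
  assumes cont: "continuous_on ({s..} \<times> UNIV) (\<lambda>(t, x). W t x)"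
    and S: "compact S" "\<And>t x. s \<le> t \<Longrightarrow> x \<notin> S \<Longrightarrow> W t x < 0"
    and init: "\<And>x. W s x < 0"
    and touch: "\<And>t x. \<lbrakk>s < t; W t x = 0; \<And>y. W t y \<le> 0; \<And>\<tau>. s \<le> \<tau> \<Longrightarrow> \<tau> \<le> t \<Longrightarrow> W \<tau> x \<le> 0\<rbrakk> \<Longrightarrow> False"
    and t: "s \<le> t"
  shows "W t x < 0"
proof (rule ccontr)
  assume neg: "\<not> W t x < 0"
  define Z where "Z = {z \<in> {s..t} \<times> S. 0 \<le> (\<lambda>(t, x). W t x) z}"
  have c: "continuous_on ({s..t} \<times> S) (\<lambda>(t, x). W t x)"
    by (rule continuous_on_subset[OF cont]) auto
  have "compact ({s..t} \<times> S)" by (intro compact_Times S) simp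
  moreover have "closedin (top_of_set ({s..t} \<times> S)) Z"
    using continuous_closedin_preimage[OF c, of "{0..}"] by (simp add: Z_def vimage_def Int_def)
  ultimately have "compact Z" using closedin_compact by blast
  moreover have "(t, x) \<in> Z" using neg S(2)[OF t] t by (auto simp: Z_def)
  ultimately obtain z where z: "z \<in> Z" "\<forall>z'\<in>Z. fst z \<le> fst z'"
    using continuous_attains_inf[of Z fst] continuous_on_fst[OF continuous_on_id] by blast
  obtain t1 x1 where z1: "z = (t1, x1)" by force
  have t1: "s \<le> t1" "t1 \<le> t" "W t1 x1 \<ge> 0" using z(1) by (auto simp: Z_def z1)
  with init[of x1] have s1: "s < t1" by (cases "s = t1") auto
  have less: "W \<tau> y < 0" if "s \<le> \<tau>" "\<tau> < t1" for \<tau> y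
  proof (rule ccontr)
    assume "\<not> W \<tau> y < 0"
    then have "(\<tau>, y) \<in> Z" using that t1 S(2)[of \<tau> y] by (auto simp: Z_def)
    then show False using z(2) that by (auto simp: z1)
  qed
  have le: "W t1 y \<le> 0" for y
  proof -
    have "continuous_on {s..t1} (\<lambda>\<tau>. (\<lambda>(t, x). W t x) (\<tau>, y))"
      by (rule continuous_on_compose2[OF cont]) (auto intro!: continuous_intros)
    then have "continuous_on {s..t1} (\<lambda>\<tau>. W \<tau> y)" by simp
    moreover have "closure {s..<t1} = {s..t1}" using s1 by simp
    ultimately show ?thesis
      using continuous_le_on_closure[of "{s..<t1}" "\<lambda>\<tau>. W \<tau> y" t1 0] less s1 by (auto intro: less_imp_le)
  qed
  show False
  proof (rule touch[OF s1])
    show "W t1 x1 = 0" using le[of x1] t1 by simp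
    show "W t1 y \<le> 0" for y by (rule le)
    show "W \<tau> x1 \<le> 0" if "s \<le> \<tau>" "\<tau> \<le> t1" for \<tau>
      using le less that by (cases "\<tau> = t1") (auto intro: less_imp_le)
  qed
qed

lemma DERIV_nonneg_of_max_left:
  fixes g :: "real \<Rightarrow> real"
  assumes "(g has_real_derivative D) (at t)" "s < t" "\<And>\<tau>. s \<le> \<tau> \<Longrightarrow> \<tau> \<le> t \<Longrightarrow> g \<tau> \<le> g t"
  shows "0 \<le> D"
proof (rule ccontr)
  assume "\<not> 0 \<le> D"
  then obtain d where d: "d > 0" "\<And>h. 0 < h \<Longrightarrow> h < d \<Longrightarrow> g t < g (t - h)"
    using DERIV_neg_dec_left[OF assms(1)] by auto
  define h where "h = min (d/2) (t - s)"
  have "0 < h" "h < d" "h \<le> t - s" using d(1) assms(2) by (auto simp: h_def)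
  then show False
    using d(2)[of h] assms(3)[of "t - h"] by simp
qed

lemma slice_norm_deriv:
  fixes w \<sigma> :: "'a::real_inner"
  assumes "w \<noteq> 0"
  shows "((\<lambda>r. norm (w + r *\<^sub>R \<sigma>)) has_real_derivative sgn w \<bullet> \<sigma>) (at 0)"
proof -
  have "((\<lambda>r. w + r *\<^sub>R \<sigma>) has_derivative (\<lambda>h. h *\<^sub>R \<sigma>)) (at 0)"
    by (auto intro!: derivative_eq_intros)
  then have "((\<lambda>r. norm (w + r *\<^sub>R \<sigma>)) has_derivative (\<lambda>h. (h *\<^sub>R \<sigma>) \<bullet> sgn (w + 0 *\<^sub>R \<sigma>))) (at 0)"
    by (rule has_derivative_compose) (use has_derivative_norm[of "w + 0 *\<^sub>R \<sigma>"] assms in \<open>simp add: inner_commute\<close>)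
  then show ?thesis
    by (simp add: has_field_derivative_def inner_commute mult_commute_abs)
qed

lemma slice_norm_sq_deriv:
  fixes w \<sigma> :: "'a::real_inner"
  shows "((\<lambda>r. (norm (w + r *\<^sub>R \<sigma>))\<^sup>2) has_real_derivative 2 * (w \<bullet> \<sigma>)) (at 0)"
proof -
  have "(\<lambda>r. (norm (w + r *\<^sub>R \<sigma>))\<^sup>2) = (\<lambda>r. w \<bullet> w + 2 * r * (w \<bullet> \<sigma>) + r\<^sup>2 * (\<sigma> \<bullet> \<sigma>))"
    unfolding power2_norm_eq_inner
    by (simp add: inner_add_left inner_add_right inner_commute power2_eq_square algebra_simps)
  then show ?thesis by (auto intro!: derivative_eq_intros)
qed

lemma has_real_derivative_penalised:
  fixes U N V S P :: "real \<Rightarrow> real"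
  assumes "(U has_real_derivative U') (at 0)" "(N has_real_derivative N') (at 0)"
    "(V has_real_derivative V') (at 0)" "(S has_real_derivative S') (at 0)"
    "(P has_real_derivative P') (at 0)"
  shows "((\<lambda>r. U r - (A * N r * V r + B * S r) - \<delta> * P r) has_real_derivative
    U' - (A * (N' * V 0 + N 0 * V') + B * S') - \<delta> * P') (at 0)"
  by (auto intro!: derivative_eq_intros assms simp: algebra_simps)

text \<open>
  A one-sided Lipschitz bound near \<open>x\<close>, tested in the direction opposite to \<open>p\<close>, bounds the gradient; the
  quadratic term is of higher order.
\<close>

lemma jet2_norm_le:
  assumes F: "jet2 F x p H" and K: "\<And>y. F x - F y \<le> c * norm (x - y) + K * (norm (x - y))\<^sup>2"
    and c: "0 \<le> c"
  shows "norm p \<le> c"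
proof (cases "p = 0")
  case False
  define g where "g r = F (x + r *\<^sub>R (- p)) + c * r * norm p + K * r\<^sup>2 * (norm p)\<^sup>2" for r
  have "(g has_real_derivative p \<bullet> (- p) + c * norm p) (at 0)"
    unfolding g_def by (auto intro!: derivative_eq_intros jet2_first[OF F, of "- p", simplified])
  moreover have "g 0 \<le> g r" if "0 \<le> r" for r
    using K[of "x + r *\<^sub>R (- p)"] that by (simp add: g_def power_mult_distrib mult_ac)
  ultimately have "0 \<le> p \<bullet> (- p) + c * norm p"
    using DERIV_neg_dec_right[of g "p \<bullet> (- p) + c * norm p" 0]
    by (metis add_0 dense less_eq_real_def not_less)
  then have "norm p * norm p \<le> c * norm p"
    by (simp add: power2_norm_eq_inner flip: power2_eq_square)
  then show ?thesis using False by simp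
qed (use c in simp)

lemma le_zero_of_small_multiples:
  fixes A B :: real
  assumes "\<And>\<delta>. 0 < \<delta> \<Longrightarrow> A \<le> \<delta> * B"
  shows "A \<le> 0"
proof (rule field_le_epsilon)
  fix e :: real assume e: "0 < e"
  have "A \<le> e / (\<bar>B\<bar> + 1) * B" by (rule assms) (use e in simp)
  also have "\<dots> \<le> e / (\<bar>B\<bar> + 1) * (\<bar>B\<bar> + 1)" using e by (intro mult_left_mono) auto
  also have "\<dots> = e" by (simp add: add_nonneg_eq_0_iff)
  finally show "A \<le> 0 + e" by simp
qed

section \<open>Supersolutions and the minimum principle\<close>

text \<open>
  The consequences of the hypotheses that drive the comparison arguments after the initial time \<open>s\<close>:
  dissipativity in its integrated form, and the Lyapunov inequality in the form that makes
  \<open>\<phi>(x) + a (t - s)\<close> a supersolution, one that tends to infinity as \<open>\<bar>x\<bar> \<rightarrow> \<infinity>\<close>.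
\<close>

locale dissipative_diffusion =
  fixes s :: real and Q :: "real \<Rightarrow> real^'n^'n" and b :: "real \<Rightarrow> real^'n \<Rightarrow> real^'n"
    and \<phi> :: "real^'n \<Rightarrow> real" and a r0 :: real
  assumes Q_sym: "s < t \<Longrightarrow> transpose (Q t) = Q t"
    and Q_psd: "s < t \<Longrightarrow> 0 \<le> (Q t *v \<xi>) \<bullet> \<xi>"
    and phi_C2: "C2 \<phi>" and phi_pos: "0 < \<phi> x" and phi_coercive: "filterlim \<phi> at_top at_infinity"
    and a_nonneg: "0 \<le> a"
    and lyapunov: "s < t \<Longrightarrow> trace (Q t ** hessian \<phi> x) + b t x \<bullet> grad \<phi> x \<le> a"
    and dissipative: "s < t \<Longrightarrow> (b t x - b t y) \<bullet> (x - y) \<le> r0 * (norm (x - y))\<^sup>2"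
begin

definition supersolution :: "(real \<Rightarrow> real^'n \<Rightarrow> real) \<Rightarrow> bool" where
  "supersolution v \<longleftrightarrow> continuous_on ({s..} \<times> UNIV) (\<lambda>(t, x). v t x) \<and>
    (\<forall>t>s. \<forall>x. \<exists>d p H. ((\<lambda>\<tau>. v \<tau> x) has_real_derivative d) (at t) \<and> jet2 (v t) x p H \<and>
       trace (Q t ** H) + b t x \<bullet> p \<le> d)"

lemma supersolutionE:
  assumes "supersolution v" "s < t"
  obtains d p H where "((\<lambda>\<tau>. v \<tau> x) has_real_derivative d) (at t)" "jet2 (v t) x p H"
    "trace (Q t ** H) + b t x \<bullet> p \<le> d"
  using assms unfolding supersolution_def by blast

lemma supersolution_cont: "supersolution v \<Longrightarrow> continuous_on ({s..} \<times> UNIV) (\<lambda>(t, x). v t x)"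
  by (simp add: supersolution_def)

lemma phi_jet2: "jet2 \<phi> x (grad \<phi> x) (hessian \<phi> x)"
  using phi_C2 by (intro jet2_hessian) (auto simp: C2_def C1_def)

lemma phi_cont: "continuous_on A \<phi>"
  using phi_C2 by (intro differentiable_imp_continuous_on)
    (auto simp: C2_def C1_def differentiable_on_def intro: differentiable_at_withinI)

lemma compact_phi_sublevel: "compact {x. \<phi> x \<le> M}"
proof -
  have "eventually (\<lambda>x. M + 1 \<le> \<phi> x) at_infinity"
    using phi_coercive by (simp add: filterlim_at_top)
  then obtain R where "\<And>x. R \<le> norm x \<Longrightarrow> M + 1 \<le> \<phi> x"
    by (auto simp: eventually_at_infinity)
  then have "{x. \<phi> x \<le> M} \<subseteq> cball 0 R" by (auto intro: ccontr simp: not_le dest!: less_imp_le) (smt (verit))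
  then have "bounded {x. \<phi> x \<le> M}" using bounded_subset bounded_cball by blast
  moreover have "closed {x. \<phi> x \<le> M}"
    by (intro closed_Collect_le phi_cont continuous_on_const)
  ultimately show ?thesis by (simp add: compact_eq_bounded_closed)
qed

lemma supersolution_add:
  assumes "supersolution v" "supersolution w"
  shows "supersolution (\<lambda>t x. v t x + w t x)"
  unfolding supersolution_def
proof (intro conjI allI impI)
  show "continuous_on ({s..} \<times> UNIV) (\<lambda>(t, x). v t x + w t x)"
    using continuous_on_add[OF supersolution_cont supersolution_cont] assms by (simp add: case_prod_unfold)
  fix t x assume t: "s < t"
  obtain d p H where 1: "((\<lambda>\<tau>. v \<tau> x) has_real_derivative d) (at t)" "jet2 (v t) x p H"
    "trace (Q t ** H) + b t x \<bullet> p \<le> d" using supersolutionE[OF assms(1) t] .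
  obtain e q K where 2: "((\<lambda>\<tau>. w \<tau> x) has_real_derivative e) (at t)" "jet2 (w t) x q K"
    "trace (Q t ** K) + b t x \<bullet> q \<le> e" using supersolutionE[OF assms(2) t] .
  show "\<exists>d p H. ((\<lambda>\<tau>. v \<tau> x + w \<tau> x) has_real_derivative d) (at t) \<and>
      jet2 (\<lambda>x. v t x + w t x) x p H \<and> trace (Q t ** H) + b t x \<bullet> p \<le> d"
    by (rule exI[of _ "d + e"], rule exI[of _ "p + q"], rule exI[of _ "H + K"])
      (use 1 2 in \<open>auto intro: DERIV_add jet2_add simp: trace_right_linear inner_add_right\<close>)
qed

lemma supersolution_scale:
  assumes "supersolution v" "0 \<le> k"
  shows "supersolution (\<lambda>t x. k * v t x)"
  unfolding supersolution_def
proof (intro conjI allI impI)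
  show "continuous_on ({s..} \<times> UNIV) (\<lambda>(t, x). k * v t x)"
    using continuous_on_mult_left[OF supersolution_cont] assms by (simp add: case_prod_unfold)
  fix t x assume t: "s < t"
  obtain d p H where 1: "((\<lambda>\<tau>. v \<tau> x) has_real_derivative d) (at t)" "jet2 (v t) x p H"
    "trace (Q t ** H) + b t x \<bullet> p \<le> d" using supersolutionE[OF assms(1) t] .
  show "\<exists>d p H. ((\<lambda>\<tau>. k * v \<tau> x) has_real_derivative d) (at t) \<and>
      jet2 (\<lambda>x. k * v t x) x p H \<and> trace (Q t ** H) + b t x \<bullet> p \<le> d"
    by (rule exI[of _ "k * d"], rule exI[of _ "k *\<^sub>R p"], rule exI[of _ "k *\<^sub>R H"])
      (use 1 mult_left_mono[OF 1(3) assms(2)] in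
        \<open>auto intro: DERIV_cmult jet2_scale simp: trace_right_linear distrib_left\<close>)
qed

lemma supersolution_lyapunov: "supersolution (\<lambda>t x. \<phi> x + a * (t - s) + 1)"
  unfolding supersolution_def
proof (intro conjI allI impI)
  show "continuous_on ({s..} \<times> UNIV) (\<lambda>(t, x). \<phi> x + a * (t - s) + 1)"
    unfolding case_prod_unfold
    by (intro continuous_intros continuous_on_compose2[OF phi_cont[of UNIV]]) auto
  fix t x assume t: "s < t"
  have "jet2 (\<lambda>x. \<phi> x + (a * (t - s) + 1)) x (grad \<phi> x + 0) (hessian \<phi> x + 0)"
    by (intro jet2_add phi_jet2 jet2_const)
  then have "jet2 (\<lambda>x. \<phi> x + a * (t - s) + 1) x (grad \<phi> x) (hessian \<phi> x)"
    by (simp add: add.assoc)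
  then show "\<exists>d p H. ((\<lambda>\<tau>. \<phi> x + a * (\<tau> - s) + 1) has_real_derivative d) (at t) \<and>
      jet2 (\<lambda>x. \<phi> x + a * (t - s) + 1) x p H \<and> trace (Q t ** H) + b t x \<bullet> p \<le> d"
    by (intro exI[of _ a] exI[of _ "grad \<phi> x"] exI[of _ "hessian \<phi> x"])
      (auto intro!: derivative_eq_intros lyapunov t)
qed

text \<open>
  A negative value of \<open>v\<close> would persist after adding a small multiple \<open>\<delta>\<close> of the coercive
  supersolution \<open>\<phi>(x) + (a + 1) (t - s) + 1\<close>. The sum is positive outside a compact set because \<open>v\<close> is
  bounded below, so it would touch zero, where the equation and the tests at an extremum contradict
  each other. Then \<open>\<delta> \<rightarrow> 0\<close>.
\<close>

lemma minimum_principle: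
  assumes v: "supersolution v" and below: "\<And>t x. s \<le> t \<Longrightarrow> - M \<le> v t x"
    and init: "\<And>x. 0 \<le> v s x" and t: "s \<le> t"
  shows "0 \<le> v t x"
proof -
  have *: "- v t x \<le> \<delta> * (\<phi> x + (a + 1) * (t - s) + 1)" if \<delta>: "0 < \<delta>" for \<delta>
  proof -
    define W where "W t x = - v t x - \<delta> * (\<phi> x + (a + 1) * (t - s) + 1)" for t x
    have tail: "0 \<le> (a + 1) * (t - s)" if "s \<le> t" for t using a_nonneg that by simp
    have "W t x < 0"
    proof (rule first_touching[OF _ compact_phi_sublevel[of "M / \<delta>"] _ _ _ t])
      show "continuous_on ({s..} \<times> UNIV) (\<lambda>(t, x). W t x)"
        unfolding W_def case_prod_unfold
        by (intro continuous_intros continuous_on_compose2[OF phi_cont[of UNIV]]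
            supersolution_cont[OF v, unfolded case_prod_unfold]) auto
      show "W t x < 0" if "s \<le> t" "x \<notin> {x. \<phi> x \<le> M / \<delta>}" for t x
      proof -
        have "M < \<delta> * \<phi> x" using that \<delta> by (simp add: field_simps not_le)
        moreover have "0 \<le> \<delta> * ((a + 1) * (t - s) + 1)" using \<delta> tail[OF that(1)] by simp
        ultimately show ?thesis using below[OF that(1), of x] by (simp add: W_def algebra_simps)
      qed
      show "W s x < 0" for x 
        using init[of x] mult_pos_pos[OF \<delta>, of "\<phi> x + 1"] phi_pos[of x] by (simp add: W_def)
    next
      fix t x
      assume t: "s < t" and "W t x = 0" and max: "\<And>y. W t y \<le> 0"
        and past: "\<And>\<tau>. s \<le> \<tau> \<Longrightarrow> \<tau> \<le> t \<Longrightarrow> W \<tau> x \<le> 0"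
      obtain d p H where d: "((\<lambda>\<tau>. v \<tau> x) has_real_derivative d) (at t)" and j: "jet2 (v t) x p H"
        and le: "trace (Q t ** H) + b t x \<bullet> p \<le> d" using supersolutionE[OF v t] .
      have "jet2 (\<lambda>y. - 1 * v t y + - \<delta> * \<phi> y) x ((- 1) *\<^sub>R p + (- \<delta>) *\<^sub>R grad \<phi> x)
          ((- 1) *\<^sub>R H + (- \<delta>) *\<^sub>R hessian \<phi> x)" (is "jet2 ?F x ?p ?H")
        by (intro jet2_add jet2_scale j phi_jet2)
      moreover have "?F y \<le> ?F x" for y
        using max[of y] \<open>W t x = 0\<close> by (simp add: W_def algebra_simps)
      ultimately have "?p = 0" "\<And>\<sigma>. (?H *v \<sigma>) \<bullet> \<sigma> \<le> 0" using jet2_max by blast+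
      then have inner0: "b t x \<bullet> ?p = 0" and trace0: "trace (Q t ** ?H) \<le> 0"
        by (auto intro!: trace_psd_nsd_nonpos Q_sym Q_psd t simp del: scaleR_minus_left scaleR_minus1_left)
      have "- (b t x \<bullet> p) - \<delta> * (b t x \<bullet> grad \<phi> x) = 0"
        using inner0 unfolding inner_add_right inner_scaleR_right by simp
      moreover have "- trace (Q t ** H) - \<delta> * trace (Q t ** hessian \<phi> x) \<le> 0"
        using trace0 unfolding trace_right_linear by simp
      moreover have "\<delta> * (trace (Q t ** hessian \<phi> x) + b t x \<bullet> grad \<phi> x) \<le> \<delta> * a"
        using \<delta> lyapunov[OF t] by simp
      moreover have "0 \<le> - d - \<delta> * (a + 1)"
        by (rule DERIV_nonneg_of_max_left[where g = "\<lambda>\<tau>. W \<tau> x" and s = s and t = t])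
          (use t past \<open>W t x = 0\<close> in \<open>auto simp: W_def intro!: derivative_eq_intros d\<close>)
      \<comment> \<open>The penalty grows in time at rate \<open>a + 1\<close>, one unit faster than the Lyapunov bound allows;
          the surplus contradicts the sign of the time derivative at the touching point.\<close>
      ultimately show False using le \<delta> by (simp add: algebra_simps)
    qed
    then show ?thesis by (simp add: W_def)
  qed
  show ?thesis using le_zero_of_small_multiples[OF *] by simp
qed

section \<open>Doubling of variables\<close>

text \<open>
  A maximum principle on \<open>\<real>\<^sup>d \<times> \<real>\<^sup>d\<close> for the difference of the two sides, penalised by
  \<open>\<phi>(x) + \<phi>(y)\<close>. At a touching point the second derivatives are tested only in the diagonal directions
  \<open>(\<sigma>, \<sigma>)\<close>. Along these \<open>x - y\<close> is constant, hence \<open>\<bar>x - y\<bar>\<close> contributes neither second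
  derivatives nor mixed terms with \<open>v\<close>, and what remains is a second-order test for a function of one
  variable in \<open>\<real>\<^sup>d\<close>. The first derivatives are tested in the directions \<open>(b(t,x), 0)\<close> and
  \<open>(0, b(t,y))\<close>, which produces the factor
  \<open>\<langle>b(t,x) - b(t,y), x - y\<rangle> \<le> r\<^sub>0 \<bar>x - y\<bar>\<^sup>2\<close>; the exponential weights compensate it exactly.
  The singularity of \<open>\<bar>x - y\<bar>\<close> on the diagonal is harmless, since there the difference is
  negative.
\<close>

lemma doubling_estimate:
  assumes u: "supersolution u" "supersolution (\<lambda>t x. - u t x)"
    and bound: "\<And>t x. s \<le> t \<Longrightarrow> \<bar>u t x\<bar> \<le> M"
    and v: "supersolution v" and v_nonneg: "\<And>t x. s \<le> t \<Longrightarrow> 0 \<le> v t x" and K: "0 \<le> K"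
    and init: "\<And>x y. u s x - u s y \<le> norm (x - y) * v s x + K * (norm (x - y))\<^sup>2"
    and t: "s \<le> t"
  shows "u t x - u t y \<le> exp (r0 * (t - s)) * norm (x - y) * v t x
           + K * (exp (r0 * (t - s)) * norm (x - y))\<^sup>2"
proof -
  define E where "E t = exp (r0 * (t - s))" for t
  have E: "0 < E t" "(E has_real_derivative r0 * E t) (at t)" for t
    unfolding E_def by (auto intro!: derivative_eq_intros)
  define N where "N t x y = E t * norm (x - y) * v t x + K * (E t * norm (x - y))\<^sup>2" for t x y
  have N: "0 \<le> N t x y" if "s \<le> t" for t x y
    using v_nonneg[OF that] E(1)[of t] K by (simp add: N_def)
  have *: "u t x - u t y - N t x y \<le> \<delta> * (\<phi> x + \<phi> y + (2 * a + 1) * (t - s) + 1)" if \<delta>: "0 < \<delta>" for \<delta>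
  proof -
    define W where "W t z = u t (fst z) - u t (snd z) - N t (fst z) (snd z)
      - \<delta> * (\<phi> (fst z) + \<phi> (snd z) + (2 * a + 1) * (t - s) + 1)" for t z
    have tail: "0 \<le> (2 * a + 1) * (t - s)" if "s \<le> t" for t using a_nonneg that by simp
    let ?S = "{x. \<phi> x \<le> 2 * M / \<delta>}"
    have "W t (x, y) < 0"
    proof (rule first_touching[OF _ compact_Times[OF compact_phi_sublevel[of "2 * M / \<delta>"]
            compact_phi_sublevel[of "2 * M / \<delta>"]] _ _ _ t])
      have c: "continuous_on ({s..} \<times> UNIV) (\<lambda>z. w (fst z) (g (snd z)))"
        if "supersolution w" "continuous_on UNIV g" for w and g :: "(real^'n) \<times> (real^'n) \<Rightarrow> real^'n"
      proof -
        have "continuous_on ({s..} \<times> UNIV) (\<lambda>z. (\<lambda>(t, x). w t x) (fst z, g (snd z)))"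
          by (rule continuous_on_compose2[OF supersolution_cont[OF that(1)]])
            (auto intro!: continuous_intros continuous_on_compose2[OF that(2)])
        then show ?thesis by simp
      qed
      show "continuous_on ({s..} \<times> UNIV) (\<lambda>(t, z). W t z)"
        unfolding W_def N_def E_def case_prod_unfold
        by (intro continuous_intros c[OF u(1), of fst] c[OF u(1), of snd] c[OF v, of fst]
            continuous_on_compose2[OF phi_cont[of UNIV]]) auto
      show "W t z < 0" if t: "s \<le> t" and "z \<notin> ?S \<times> ?S" for t z
      proof -
        obtain x y where z: "z = (x, y)" by force
        have "2 * M < \<delta> * \<phi> x \<or> 2 * M < \<delta> * \<phi> y" using that(2) \<delta> by (auto simp: z field_simps not_le)
        moreover have "0 < \<delta> * \<phi> x" "0 < \<delta> * \<phi> y" using \<delta> phi_pos by simp_all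
        ultimately have "2 * M < \<delta> * \<phi> x + \<delta> * \<phi> y" by linarith
        moreover have "0 \<le> \<delta> * ((2 * a + 1) * (t - s) + 1)" using \<delta> tail[OF t] by simp
        ultimately show ?thesis using bound[OF t, of x] bound[OF t, of y] N[OF t, of x y]
          by (simp add: W_def z distrib_left)
      qed
      show "W s z < 0" for z
      proof -
        have "0 < \<delta> * (\<phi> (fst z) + \<phi> (snd z) + 1)" using \<delta> phi_pos by (simp add: add_pos_pos)
        then show ?thesis using init[of "fst z" "snd z"] by (simp add: W_def N_def E_def)
      qed
    next
      fix t z
      assume t: "s < t" and zero: "W t z = 0" and max: "\<And>z'. W t z' \<le> 0"
        and past: "\<And>\<tau>. s \<le> \<tau> \<Longrightarrow> \<tau> \<le> t \<Longrightarrow> W \<tau> z \<le> 0"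
      obtain x y where z: "z = (x, y)" by force
      have "x \<noteq> y"
      proof
        assume "x = y"
        moreover have "0 < \<delta> * (\<phi> y + \<phi> y + (2 * a + 1) * (t - s) + 1)"
          using \<delta> phi_pos[of y] tail[of t] t by simp
        ultimately show False using zero by (auto simp: W_def z N_def)
      qed
      define e where "e = y - x"
      define c where "c = E t * norm (x - y)"
      define n where "n = sgn (x - y)"
      obtain d1 p1 H1 where d1: "((\<lambda>\<tau>. - u \<tau> x) has_real_derivative d1) (at t)"
        and j1: "jet2 (\<lambda>x. - u t x) x p1 H1" and le1: "trace (Q t ** H1) + b t x \<bullet> p1 \<le> d1"
        using supersolutionE[OF u(2) t] .
      obtain d2 p2 H2 where d2: "((\<lambda>\<tau>. u \<tau> y) has_real_derivative d2) (at t)"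
        and j2: "jet2 (u t) y p2 H2" and le2: "trace (Q t ** H2) + b t y \<bullet> p2 \<le> d2"
        using supersolutionE[OF u(1) t] .
      obtain d3 p3 H3 where d3: "((\<lambda>\<tau>. v \<tau> x) has_real_derivative d3) (at t)"
        and j3: "jet2 (v t) x p3 H3" and le3: "trace (Q t ** H3) + b t x \<bullet> p3 \<le> d3"
        using supersolutionE[OF v t] .
      \<comment> \<open>Motion in diagonal directions: both points are shifted together, \<open>y\<close> being \<open>x + e\<close>, so the
          functions at \<open>y\<close> enter through their jets there.\<close>
      have "jet2 (\<lambda>z. - 1 * (- u t z) + (- 1 * u t (z + e) + (- c * v t z +
            (- \<delta> * \<phi> z + - \<delta> * \<phi> (z + e))))) x
          ((- 1) *\<^sub>R p1 + ((- 1) *\<^sub>R p2 + ((- c) *\<^sub>R p3 +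
            ((- \<delta>) *\<^sub>R grad \<phi> x + (- \<delta>) *\<^sub>R grad \<phi> y))))
          ((- 1) *\<^sub>R H1 + ((- 1) *\<^sub>R H2 + ((- c) *\<^sub>R H3 +
            ((- \<delta>) *\<^sub>R hessian \<phi> x + (- \<delta>) *\<^sub>R hessian \<phi> y))))" (is "jet2 ?F x ?p ?H")
        by (intro jet2_add jet2_scale jet2_shift[of _ x e] j1 j3 phi_jet2)
          (use j2 phi_jet2 in \<open>simp_all add: e_def\<close>)
      moreover have "?F x' \<le> ?F x" for x'
        using max[of "(x', x' + e)"] zero
        by (simp add: W_def z N_def c_def e_def norm_minus_commute algebra_simps)
      ultimately have "\<And>\<sigma>. (?H *v \<sigma>) \<bullet> \<sigma> \<le> 0" using jet2_max by blast
      then have "trace (Q t ** ?H) \<le> 0"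
        by (intro trace_psd_nsd_nonpos Q_sym Q_psd t)
      then have T: "- trace (Q t ** H1) - trace (Q t ** H2) - c * trace (Q t ** H3)
          - \<delta> * trace (Q t ** hessian \<phi> x) - \<delta> * trace (Q t ** hessian \<phi> y) \<le> 0"
        unfolding trace_right_linear by simp
      have A1: "- (p1 \<bullet> \<sigma>) - E t * (n \<bullet> \<sigma>) * v t x - c * (p3 \<bullet> \<sigma>)
          - 2 * K * (E t)\<^sup>2 * ((x - y) \<bullet> \<sigma>) - \<delta> * (grad \<phi> x \<bullet> \<sigma>) = 0" for \<sigma>
      proof -
        have dU: "((\<lambda>r. u t (x + r *\<^sub>R \<sigma>) - u t y) has_real_derivative - (p1 \<bullet> \<sigma>)) (at 0)"
          using DERIV_diff[OF DERIV_minus[OF jet2_first[OF j1, of \<sigma>]] DERIV_const[of "u t y"]] by simp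
        have dP: "((\<lambda>r. \<phi> (x + r *\<^sub>R \<sigma>) + \<phi> y + (2 * a + 1) * (t - s) + 1)
            has_real_derivative grad \<phi> x \<bullet> \<sigma>) (at 0)"
          using DERIV_add[OF jet2_first[OF phi_jet2, of x \<sigma>]
              DERIV_const[of "\<phi> y + (2 * a + 1) * (t - s) + 1"]] by (simp add: add.assoc)
        have w: "x - y + r *\<^sub>R \<sigma> = x + r *\<^sub>R \<sigma> - y" for r by simp
        have "x - y \<noteq> 0" using \<open>x \<noteq> y\<close> by simp
        from has_real_derivative_penalised[OF dU slice_norm_deriv[OF this, of \<sigma>]
            jet2_first[OF j3, of \<sigma>] slice_norm_sq_deriv[of "x - y" \<sigma>] dP, of "E t" "K * (E t)\<^sup>2" \<delta>]
        have "((\<lambda>r. W t (x + r *\<^sub>R \<sigma>, y)) has_real_derivative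
            (- (p1 \<bullet> \<sigma>) - E t * (n \<bullet> \<sigma>) * v t x - c * (p3 \<bullet> \<sigma>)
          - 2 * K * (E t)\<^sup>2 * ((x - y) \<bullet> \<sigma>) - \<delta> * (grad \<phi> x \<bullet> \<sigma>))) (at 0)"
          unfolding w by (simp add: W_def N_def c_def n_def power_mult_distrib algebra_simps)
        then show ?thesis
          by (rule DERIV_local_max[of _ _ _ 1]) (use zero max in \<open>simp_all add: z\<close>)
      qed
      have A2: "- (p2 \<bullet> \<sigma>) + E t * (n \<bullet> \<sigma>) * v t x
          + 2 * K * (E t)\<^sup>2 * ((x - y) \<bullet> \<sigma>) - \<delta> * (grad \<phi> y \<bullet> \<sigma>) = 0" for \<sigma>
      proof -
        have dU: "((\<lambda>r. u t x - u t (y + r *\<^sub>R \<sigma>)) has_real_derivative - (p2 \<bullet> \<sigma>)) (at 0)"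
          using DERIV_diff[OF DERIV_const[of "u t x"] jet2_first[OF j2, of \<sigma>]] by simp
        have dP: "((\<lambda>r. \<phi> x + \<phi> (y + r *\<^sub>R \<sigma>) + (2 * a + 1) * (t - s) + 1)
            has_real_derivative grad \<phi> y \<bullet> \<sigma>) (at 0)"
          using DERIV_add[OF jet2_first[OF phi_jet2, of y \<sigma>]
              DERIV_const[of "\<phi> x + (2 * a + 1) * (t - s) + 1"]] by (simp add: add_ac)
        have w: "x - y + r *\<^sub>R (- \<sigma>) = x - (y + r *\<^sub>R \<sigma>)" for r by simp
        have "x - y \<noteq> 0" using \<open>x \<noteq> y\<close> by simp
        from has_real_derivative_penalised[OF dU slice_norm_deriv[OF this, of "- \<sigma>"]
            DERIV_const[of "v t x"] slice_norm_sq_deriv[of "x - y" "- \<sigma>"] dP, of "E t" "K * (E t)\<^sup>2" \<delta>]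
        have "((\<lambda>r. W t (x, y + r *\<^sub>R \<sigma>)) has_real_derivative
            (- (p2 \<bullet> \<sigma>) + E t * (n \<bullet> \<sigma>) * v t x
          + 2 * K * (E t)\<^sup>2 * ((x - y) \<bullet> \<sigma>) - \<delta> * (grad \<phi> y \<bullet> \<sigma>))) (at 0)"
          unfolding w by (simp add: W_def N_def n_def power_mult_distrib algebra_simps)
        then show ?thesis
          by (rule DERIV_local_max[of _ _ _ 1]) (use zero max in \<open>simp_all add: z\<close>)
      qed
      have time: "0 \<le> - d1 - d2 - (r0 * c * v t x + c * d3) - 2 * r0 * K * c\<^sup>2 - \<delta> * (2 * a + 1)"
      proof (rule DERIV_nonneg_of_max_left[where g = "\<lambda>\<tau>. W \<tau> z" and s = s and t = t])
        have "((\<lambda>\<tau>. - (- u \<tau> x) - u \<tau> y - (E \<tau> * norm (x - y) * v \<tau> x + K * (E \<tau> * norm (x - y))\<^sup>2)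
            - \<delta> * (\<phi> x + \<phi> y + (2 * a + 1) * (\<tau> - s) + 1)) has_real_derivative
            - d1 - d2 - (r0 * c * v t x + c * d3) - 2 * r0 * K * c\<^sup>2 - \<delta> * (2 * a + 1)) (at t)"
          by (rule derivative_eq_intros d1 d2 d3 E(2) refl)+
            (simp add: c_def algebra_simps power2_eq_square)
        then show "((\<lambda>\<tau>. W \<tau> z) has_real_derivative
            - d1 - d2 - (r0 * c * v t x + c * d3) - 2 * r0 * K * c\<^sup>2 - \<delta> * (2 * a + 1)) (at t)"
          by (simp add: W_def N_def z)
      qed (use t past zero in auto)
      have c: "0 \<le> c" using E(1)[of t] by (simp add: c_def)
      have D: "(x - y) \<bullet> (b t x - b t y) \<le> r0 * (norm (x - y))\<^sup>2"
        using dissipative[OF t, of x y] by (simp add: inner_commute)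
      have "n \<bullet> (b t x - b t y) = ((x - y) \<bullet> (b t x - b t y)) / norm (x - y)"
        by (simp add: n_def sgn_div_norm divide_inverse_commute)
      also have "\<dots> \<le> r0 * norm (x - y)"
        using D \<open>x \<noteq> y\<close> by (simp add: divide_le_eq power2_eq_square mult_ac)
      finally have "E t * v t x * (n \<bullet> (b t x - b t y)) \<le> E t * v t x * (r0 * norm (x - y))"
        using E(1)[of t] v_nonneg[of t x] t by (intro mult_left_mono) auto
      then have B1: "E t * v t x * (n \<bullet> (b t x - b t y)) \<le> r0 * c * v t x"
        by (simp add: c_def mult_ac)
      have "2 * K * (E t)\<^sup>2 * ((x - y) \<bullet> (b t x - b t y)) \<le> 2 * K * (E t)\<^sup>2 * (r0 * (norm (x - y))\<^sup>2)"
        using K D by (intro mult_left_mono) auto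
      then have B2: "2 * K * (E t)\<^sup>2 * ((x - y) \<bullet> (b t x - b t y)) \<le> 2 * r0 * K * c\<^sup>2"
        by (simp add: c_def power_mult_distrib mult_ac)
      have L: "\<delta> * (trace (Q t ** hessian \<phi> w) + b t w \<bullet> grad \<phi> w) \<le> \<delta> * a" for w
        using \<delta> lyapunov[OF t] by simp
      have "c * (trace (Q t ** H3) + b t x \<bullet> p3) \<le> c * d3" using le3 c by (rule mult_left_mono)
      \<comment> \<open>Combining all tests leaves \<open>0 \<le> 2 a \<delta> - (2 a + 1) \<delta>\<close>.\<close>
      with T A1[of "b t x"] A2[of "b t y"] time B1 B2 L[of x] L[of y] le1 le2 \<delta>
      show False by (simp add: inner_diff_right inner_commute[of p1] inner_commute[of p2]
            inner_commute[of p3] inner_commute[of "grad \<phi> _"] distrib_left right_diff_distrib mult_ac)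
    qed
    then show ?thesis by (simp add: W_def)
  qed
  show ?thesis using le_zero_of_small_multiples[OF *] by (simp add: N_def E_def)
qed

end

section \<open>Bounded classical solutions\<close>

lemma mean_value_grad:
  assumes "\<And>y. h differentiable (at y)"
  shows "\<exists>z\<in>closed_segment x y. h x - h y = grad h z \<bullet> (x - y)"
proof -
  have "\<exists>r>0. r < 1 \<and> h (y + 1 *\<^sub>R (x - y)) - h (y + 0 *\<^sub>R (x - y)) = (1 - 0) * (grad h (y + r *\<^sub>R (x - y)) \<bullet> (x - y))"
    by (rule MVT2[of 0 1 "\<lambda>r. h (y + r *\<^sub>R (x - y))" "\<lambda>r. grad h (y + r *\<^sub>R (x - y)) \<bullet> (x - y)"])
      (simp_all add: has_real_derivative_slice[OF assms])
  then obtain r where r: "0 < r" "r < 1" "h x - h y = grad h (y + r *\<^sub>R (x - y)) \<bullet> (x - y)" by auto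
  moreover have "y + r *\<^sub>R (x - y) \<in> closed_segment x y"
    using r by (auto simp: closed_segment_def algebra_simps intro!: exI[of _ "1 - r"])
  ultimately show ?thesis by blast
qed

lemma Cb1_Lipschitz:
  assumes "h \<in> Cb1"
  obtains L where "0 \<le> L" "\<And>x. norm (grad h x) \<le> L" "\<And>x y. h x - h y \<le> L * norm (x - y)"
proof -
  obtain L where L: "\<And>x. norm (grad h x) \<le> L"
    using assms by (auto simp: Cb1_def bounded_iff)
  have "h x - h y \<le> L * norm (x - y)" for x y
  proof -
    obtain z where "h x - h y = grad h z \<bullet> (x - y)"
      using mean_value_grad[of h x y] assms by (auto simp: Cb1_def C1_def)
    then have "h x - h y \<le> norm (grad h z) * norm (x - y)" by (simp add: norm_cauchy_schwarz)
    then show ?thesis using L[of z] mult_right_mono[of _ _ "norm (x - y)"] by fastforce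
  qed
  with L show ?thesis using that[of L] norm_ge_zero[of "grad h 0"] by (meson order_trans)
qed

lemma solution_derivatives:
  assumes sol: "bounded_classical_solution Q b s f u" and t: "s < t"
  shows "((\<lambda>\<tau>. u \<tau> x) has_real_derivative
      trace (Q t ** hessian (u t) x) + b t x \<bullet> grad (u t) x) (at t)"
    and "jet2 (u t) x (grad (u t) x) (hessian (u t) x)"
proof -
  have "(\<lambda>\<tau>. u \<tau> x) differentiable (at t)" "deriv (\<lambda>\<tau>. u \<tau> x) t = kolmogorov_op Q b t (u t) x"
    using sol t by (auto simp: bounded_classical_solution_def C12_def)
  then show "((\<lambda>\<tau>. u \<tau> x) has_real_derivative
      trace (Q t ** hessian (u t) x) + b t x \<bullet> grad (u t) x) (at t)"
    by (metis DERIV_deriv_iff_real_differentiable kolmogorov_op_def)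
  show "jet2 (u t) x (grad (u t) x) (hessian (u t) x)"
    using sol t by (intro jet2_hessian) (auto simp: bounded_classical_solution_def C12_def)
qed

lemma solution_bounded:
  assumes "bounded_classical_solution Q b s f u"
  shows "\<exists>M. \<forall>t\<ge>s. \<forall>x. \<bar>u t x\<bar> \<le> M"
proof -
  have "bounded ((\<lambda>(t, x). u t x) ` ({s..} \<times> UNIV))"
    using assms by (simp add: bounded_classical_solution_def)
  then obtain M where M: "\<forall>z\<in>(\<lambda>(t, x). u t x) ` ({s..} \<times> UNIV). norm z \<le> M"
    unfolding bounded_iff by blast
  have "\<bar>u t x\<bar> \<le> M" if "s \<le> t" for t x
    using bspec[OF M, of "u t x"] that by force
  then show ?thesis by blast
qed

lemma solution_Cb:
  assumes sol: "bounded_classical_solution Q b s f u" and t: "s \<le> t"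
  shows "u t \<in> Cb"
proof -
  have "continuous_on ({s..} \<times> UNIV) (\<lambda>(t, x). u t x)"
    using sol by (simp add: bounded_classical_solution_def)
  then have "continuous_on UNIV (\<lambda>x. (\<lambda>(t, x). u t x) (t, x))"
    by (rule continuous_on_compose2) (use t in \<open>auto intro!: continuous_intros\<close>)
  moreover obtain M where "\<And>x. \<bar>u t x\<bar> \<le> M" using solution_bounded[OF sol] t by metis
  ultimately show ?thesis by (auto simp: Cb_def bounded_iff)
qed

lemma solution_initial: "bounded_classical_solution Q b s f u \<Longrightarrow> u s x = f x"
  by (simp add: bounded_classical_solution_def)

lemma Cb_integrable:
  assumes "f \<in> Cb" "prob_space M" "sets M = sets borel"
  shows "integrable M f"
proof -
  interpret prob_space M by fact
  have "f \<in> borel_measurable M"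
    using borel_measurable_continuous_onI[of f] assms(1) measurable_cong_sets[OF assms(3) refl]
    by (auto simp: Cb_def)
  moreover obtain B where "\<And>x. norm (f x) \<le> B" using assms(1) by (auto simp: Cb_def bounded_iff)
  ultimately show ?thesis by (intro integrable_const_bound[of _ B]) auto
qed

text \<open>
  The infimum over \<open>\<kappa>\<close> of the bound is \<open>sqrt (w u)\<close>. The choice \<open>\<kappa> = N / u\<close>, made instead of the minimiser
  \<open>sqrt (w / u)\<close>, reaches the same conclusion and covers \<open>w = 0\<close> as well.
\<close>

lemma power2_le_mult_of_AM_GM_bounds:
  fixes N u w :: real
  assumes "0 \<le> N" "0 < u" "0 \<le> w" and *: "\<And>\<kappa>. 0 < \<kappa> \<Longrightarrow> N \<le> w / (2 * \<kappa>) + \<kappa> * u / 2"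
  shows "N\<^sup>2 \<le> w * u"
proof (cases "N = 0")
  case False
  with \<open>0 \<le> N\<close> have N: "0 < N" by simp
  have "N \<le> w / (2 * (N / u)) + N / u * u / 2" by (rule *) (use N \<open>0 < u\<close> in simp)
  also have "\<dots> = w * u / (2 * N) + N / 2" using \<open>0 < u\<close> by simp
  finally have "N / 2 \<le> w * u / (2 * N)" by linarith
  then show ?thesis using N by (simp add: pos_le_divide_eq power2_eq_square mult_ac)
qed (use assms in simp)

context dissipative_diffusion begin

lemma solution_supersolution:
  assumes sol: "bounded_classical_solution Q b s f u"
  shows "supersolution u" "supersolution (\<lambda>t x. - u t x)"
proof -
  have c: "continuous_on ({s..} \<times> UNIV) (\<lambda>(t, x). u t x)"
    using sol by (simp add: bounded_classical_solution_def)
  show "supersolution u"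
    unfolding supersolution_def using c solution_derivatives[OF sol] by blast
  show "supersolution (\<lambda>t x. - u t x)"
    unfolding supersolution_def
  proof (intro conjI allI impI)
    show "continuous_on ({s..} \<times> UNIV) (\<lambda>(t, x). - u t x)"
      using continuous_on_minus[OF c] by (simp add: case_prod_unfold)
    fix t x assume t: "s < t"
    note d = solution_derivatives[OF sol t, of x]
    show "\<exists>d p H. ((\<lambda>\<tau>. - u \<tau> x) has_real_derivative d) (at t) \<and> jet2 (\<lambda>x. - u t x) x p H \<and>
       trace (Q t ** H) + b t x \<bullet> p \<le> d"
      using DERIV_minus[OF d(1)] jet2_scale[OF d(2), of "- 1"]
      by (intro exI[of _ "- (trace (Q t ** hessian (u t) x) + b t x \<bullet> grad (u t) x)"]
          exI[of _ "- grad (u t) x"] exI[of _ "- hessian (u t) x"]) (auto simp: trace_right_linear)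
  qed
qed

text \<open>
  Constants solve the equation, so this is the minimum principle for \<open>u - c\<close>; it yields the
  positivity of \<open>G(t,s)\<close>.
\<close>

lemma solution_lower_bound:
  assumes sol: "bounded_classical_solution Q b s f u" and f: "\<And>x. c \<le> f x" and t: "s \<le> t"
  shows "c \<le> u t x"
proof -
  obtain M where M: "\<And>t x. s \<le> t \<Longrightarrow> \<bar>u t x\<bar> \<le> M" using solution_bounded[OF sol] by blast
  have const: "supersolution (\<lambda>t x. - c)"
    unfolding supersolution_def using jet2_const[of "- c"]
    by (auto intro!: exI[of _ 0] exI[of _ "0 :: real^'n"] exI[of _ "0 :: real^'n^'n"] simp: trace_def)
  have "0 \<le> u t x + - c"
  proof (rule minimum_principle[OF supersolution_add[OF solution_supersolution(1)[OF sol] const] _ _ t])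
    show "- (M + \<bar>c\<bar>) \<le> u t x + - c" if "s \<le> t" for t x using M[OF that, of x] by linarith
    show "0 \<le> u s x + - c" for x using f[of x] by (simp add: solution_initial[OF sol])
  qed
  then show ?thesis by simp
qed

section \<open>The gradient estimate\<close>

text \<open>
  The initial condition for the doubling argument. To first order \<open>h(x) - h(y)\<close> is
  \<open>\<bar>\<nabla>h(x)\<bar> \<bar>x - y\<bar>\<close>, with an error governed by the modulus of continuity of \<open>\<nabla>h\<close>. That
  modulus is uniform only on compact sets, which is why \<open>\<phi>\<close> appears: where \<open>\<phi>\<close> is large, the
  term \<open>\<epsilon> \<phi>(x)\<close> alone exceeds the Lipschitz constant of \<open>h\<close>; on the remaining compact set near
  points are covered by \<open>\<epsilon>\<close> and distant ones by the quadratic term.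
\<close>

lemma initial_doubling:
  assumes h: "h \<in> Cb1" and \<epsilon>: "0 < \<epsilon>"
  obtains K where "0 \<le> K"
    "\<And>x y. h x - h y \<le> norm (x - y) * (norm (grad h x) + \<epsilon> * (\<phi> x + 1)) + K * (norm (x - y))\<^sup>2"
proof -
  obtain L where L: "0 \<le> L" "\<And>x. norm (grad h x) \<le> L" "\<And>x y. h x - h y \<le> L * norm (x - y)"
    using Cb1_Lipschitz[OF h] by blast
  obtain R where R: "\<And>x. \<phi> x \<le> L / \<epsilon> \<Longrightarrow> norm x \<le> R"
    using compact_imp_bounded[OF compact_phi_sublevel[of "L / \<epsilon>"]] by (auto simp: bounded_iff)
  have "uniformly_continuous_on (cball 0 (R + 1)) (grad h)"
    using h by (intro compact_uniformly_continuous) (auto simp: Cb1_def C1_def intro: continuous_on_subset)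
  then obtain d where d: "0 < d"
    "\<And>x z. x \<in> cball 0 (R + 1) \<Longrightarrow> z \<in> cball 0 (R + 1) \<Longrightarrow> dist z x < d \<Longrightarrow> dist (grad h z) (grad h x) < \<epsilon>"
    using \<epsilon> unfolding uniformly_continuous_on_def by metis
  define \<rho> where "\<rho> = min d 1"
  have \<rho>: "0 < \<rho>" "\<rho> \<le> d" "\<rho> \<le> 1" using d(1) by (auto simp: \<rho>_def)
  have "h x - h y \<le> norm (x - y) * (norm (grad h x) + \<epsilon> * (\<phi> x + 1)) + L / \<rho> * (norm (x - y))\<^sup>2" for x y
  proof -
    have pos: "0 \<le> norm (x - y) * (norm (grad h x) + \<epsilon> * (\<phi> x + 1))" "0 \<le> L / \<rho> * (norm (x - y))\<^sup>2"
      using \<epsilon> phi_pos[of x] L(1) \<rho> by auto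
    consider (far) "\<rho> \<le> norm (x - y)" | (outside) "L / \<epsilon> < \<phi> x" | (close) "norm (x - y) < \<rho>" "\<phi> x \<le> L / \<epsilon>"
      by linarith
    then show ?thesis
    proof cases
      case far
      have "L * norm (x - y) \<le> L * norm (x - y) * (norm (x - y) / \<rho>)"
        using far \<rho>(1) L(1) mult_left_mono[of 1 "norm (x - y) / \<rho>" "L * norm (x - y)"] by simp
      then show ?thesis using L(3)[of x y] pos(1) by (simp add: power2_eq_square mult_ac)
    next
      case outside
      then have "L < \<epsilon> * \<phi> x" using \<epsilon> by (simp add: field_simps)
      then have "L \<le> norm (grad h x) + \<epsilon> * (\<phi> x + 1)"
        using \<epsilon> norm_ge_zero[of "grad h x"] unfolding distrib_left by linarith
      then have "norm (x - y) * L \<le> norm (x - y) * (norm (grad h x) + \<epsilon> * (\<phi> x + 1))"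
        by (rule mult_left_mono) simp
      then show ?thesis using L(3)[of x y] pos(2) by (simp add: mult.commute)
    next
      case close
      obtain z where z: "z \<in> closed_segment x y" "h x - h y = grad h z \<bullet> (x - y)"
        using mean_value_grad[of h x y] h by (auto simp: Cb1_def C1_def)
      have zx: "norm (z - x) \<le> norm (x - y)" using segment_bound(1)[OF z(1)] by (simp add: norm_minus_commute)
      have "norm x \<le> R" using R close by blast
      moreover have "norm z \<le> norm x + norm (z - x)" by (metis add.commute diff_add_cancel norm_triangle_ineq)
      ultimately have "dist (grad h z) (grad h x) < \<epsilon>"
        using zx close \<rho> by (intro d(2)) (auto simp: dist_norm)
      then have "norm (grad h z) \<le> norm (grad h x) + \<epsilon>"
        using norm_triangle_sub[of "grad h z" "grad h x"] by (simp add: dist_norm)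
      moreover have "0 < \<epsilon> * \<phi> x" using \<epsilon> phi_pos by simp
      ultimately have "norm (grad h z) \<le> norm (grad h x) + \<epsilon> * (\<phi> x + 1)" by (simp add: distrib_left)
      then have "norm (grad h z) * norm (x - y) \<le> (norm (grad h x) + \<epsilon> * (\<phi> x + 1)) * norm (x - y)"
        by (rule mult_right_mono) simp
      moreover have "h x - h y \<le> norm (grad h z) * norm (x - y)"
        by (simp add: z(2) norm_cauchy_schwarz)
      ultimately show ?thesis using pos(2) by (simp add: mult.commute)
    qed
  qed
  then show ?thesis using that[of "L / \<rho>"] L(1) \<rho>(1) by simp
qed

text \<open>
  The bound behind the sharp constant: it contains the factor \<open>exp (2 r\<^sub>0 (t - s))\<close> and no further
  loss. The supersolution used in the doubling argument is \<open>w / (2\<kappa>) + \<kappa> u / 2\<close>, which replaces the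
  Cauchy-Schwarz inequality for the positive operator \<open>G(t,s)\<close>, plus a multiple \<open>\<epsilon>\<close> of the Lyapunov
  supersolution absorbing the error in \<open>initial_doubling\<close>. The quadratic constant \<open>K\<close> depends on
  \<open>\<epsilon>\<close> and \<open>\<kappa>\<close>, but it disappears in the gradient before \<open>\<epsilon> \<rightarrow> 0\<close>.
\<close>

lemma gradient_estimate:
  assumes h: "h \<in> Cb1" and \<delta>: "0 < \<delta>" "\<And>x. \<delta> \<le> h x"
    and u: "bounded_classical_solution Q b s h u"
    and w: "bounded_classical_solution Q b s (\<lambda>x. (norm (grad h x))\<^sup>2 / h x) w"
    and t: "s < t"
  shows "(norm (grad (u t) x))\<^sup>2 \<le> exp (2 * r0 * (t - s)) * (w t x * u t x)"
proof -
  define E where "E = exp (r0 * (t - s))"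
  have E: "0 < E" by (simp add: E_def)
  have h_pos: "0 < h x" for x using \<delta>(1) \<delta>(2)[of x] by linarith
  have u_pos: "0 < u t x" if "s \<le> t" for t x
    using solution_lower_bound[OF u \<delta>(2) that, of x] \<delta>(1) by linarith
  have w_nonneg: "0 \<le> w t x" if "s \<le> t" for t x
    by (rule solution_lower_bound[OF w _ that]) (use h_pos less_imp_le in \<open>auto intro: divide_nonneg_pos\<close>)
  obtain M where M: "\<And>t x. s \<le> t \<Longrightarrow> \<bar>u t x\<bar> \<le> M" using solution_bounded[OF u] by blast
  have AM_GM: "norm (grad (u t) x) / E \<le> w t x / (2 * \<kappa>) + \<kappa> * u t x / 2" if \<kappa>: "0 < \<kappa>" for \<kappa>
  proof -
    define v where "v \<epsilon> t x = 1 / (2 * \<kappa>) * w t x + (\<kappa> / 2 * u t x + \<epsilon> * (\<phi> x + a * (t - s) + 1))" for \<epsilon> t x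
    have "norm (grad (u t) x) \<le> E * v \<epsilon> t x" if \<epsilon>: "0 < \<epsilon>" for \<epsilon>
    proof -
      have v: "supersolution (v \<epsilon>)"
        unfolding v_def using \<kappa> \<epsilon>
        by (intro supersolution_add supersolution_scale supersolution_lyapunov
            solution_supersolution(1)[OF u] solution_supersolution(1)[OF w]) auto
      have v_nonneg: "0 \<le> v \<epsilon> t x" if "s \<le> t" for t x
        using u_pos[OF that, of x] w_nonneg[OF that, of x] \<kappa> \<epsilon> phi_pos[of x] a_nonneg that
        by (simp add: v_def)
      obtain K where K: "0 \<le> K" "\<And>x y. h x - h y \<le> norm (x - y) * (norm (grad h x) + \<epsilon> * (\<phi> x + 1))
          + K * (norm (x - y))\<^sup>2"
        using initial_doubling[OF h \<epsilon>] by metis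
      have young: "norm (grad h x) + \<epsilon> * (\<phi> x + 1) \<le> v \<epsilon> s x" for x
      proof -
        \<comment> \<open>Young's inequality \<open>\<bar>\<nabla>h\<bar> \<le> \<bar>\<nabla>h\<bar>\<^sup>2 / (2 \<kappa> h) + \<kappa> h / 2\<close>, as a completed square.\<close>
        have "0 \<le> (norm (grad h x) - \<kappa> * h x)\<^sup>2 / (2 * \<kappa> * h x)"
          using \<kappa> h_pos[of x] by simp
        also have "\<dots> = 1 / (2 * \<kappa>) * ((norm (grad h x))\<^sup>2 / h x) + \<kappa> / 2 * h x - norm (grad h x)"
          using \<kappa> h_pos[of x] by (simp add: field_simps power2_eq_square)
        finally show ?thesis
          by (simp add: v_def solution_initial[OF u] solution_initial[OF w])
      qed
      have "u t x - u t y \<le> exp (r0 * (t - s)) * norm (x - y) * v \<epsilon> t x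
          + K * (exp (r0 * (t - s)) * norm (x - y))\<^sup>2" for y
      proof (rule doubling_estimate[OF solution_supersolution[OF u] M v v_nonneg K(1)])
        fix x y
        have "norm (x - y) * (norm (grad h x) + \<epsilon> * (\<phi> x + 1)) \<le> norm (x - y) * v \<epsilon> s x"
          using young by (rule mult_left_mono) simp
        then show "u s x - u s y \<le> norm (x - y) * v \<epsilon> s x + K * (norm (x - y))\<^sup>2"
          using K(2)[of x y] by (simp add: solution_initial[OF u])
      qed (use t in auto)
      then have "u t x - u t y \<le> E * v \<epsilon> t x * norm (x - y) + K * E\<^sup>2 * (norm (x - y))\<^sup>2" for y
        by (simp add: E_def power_mult_distrib mult_ac)
      then show ?thesis
        by (rule jet2_norm_le[OF solution_derivatives(2)[OF u t]]) (use E v_nonneg[of t x] t in simp)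
    qed
    then have "norm (grad (u t) x) / E \<le> v \<epsilon> t x" if "0 < \<epsilon>" for \<epsilon>
      using that E by (simp add: pos_divide_le_eq mult.commute[of E])
    then have "norm (grad (u t) x) / E - (w t x / (2 * \<kappa>) + \<kappa> * u t x / 2) \<le> \<epsilon> * (\<phi> x + a * (t - s) + 1)"
      if "0 < \<epsilon>" for \<epsilon>
      using that by (fastforce simp: v_def)
    from le_zero_of_small_multiples[OF this] show ?thesis by simp
  qed
  have "(norm (grad (u t) x) / E)\<^sup>2 \<le> w t x * u t x"
    by (rule power2_le_mult_of_AM_GM_bounds[OF _ _ _ AM_GM])
      (use E u_pos[of t x] w_nonneg[of t x] t in auto)
  moreover have "E\<^sup>2 = exp (2 * r0 * (t - s))"
    by (simp add: E_def mult.assoc flip: exp_double)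
  ultimately show ?thesis using E by (simp add: power_divide field_simps)
qed

section \<open>The logarithmic Sobolev inequality for the evolution operator\<close>

text \<open>
  Both sides agree at time \<open>s\<close> once the constant is replaced by the function \<open>k\<close> with \<open>k(s) = 0\<close> and
  \<open>k'(t) = \<Lambda> exp (2 r\<^sub>0 (t - s))\<close>, which increases to at most that constant. Applying \<open>D\<^sub>t - A(t)\<close> to
  \<open>u ln u\<close> leaves the defect \<open>- \<langle>Q \<nabla>u, \<nabla>u\<rangle> / u\<close>; the gradient estimate bounds its size by
  \<open>k'(t) w\<close>, precisely what \<open>k(t) w\<close> produces, so the right-hand side is a supersolution. The
  lower bound \<open>\<delta>\<close> keeps \<open>u\<close> away from the singularity of the logarithm.
\<close>

lemma local_log_Sobolev:
  assumes h: "h \<in> Cb1" and \<delta>: "0 < \<delta>" "\<And>x. \<delta> \<le> h x"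
    and r0: "r0 < 0" and Q_le: "\<And>t \<xi>. s < t \<Longrightarrow> (Q t *v \<xi>) \<bullet> \<xi> \<le> \<Lambda> * (norm \<xi>)\<^sup>2" and \<Lambda>: "0 \<le> \<Lambda>"
    and u: "bounded_classical_solution Q b s h u"
    and w: "bounded_classical_solution Q b s (\<lambda>x. (norm (grad h x))\<^sup>2 / h x) w"
    and g: "bounded_classical_solution Q b s (\<lambda>x. h x * ln (h x)) g"
    and t: "s \<le> t"
  shows "g t x \<le> u t x * ln (u t x) + \<Lambda> / (2 * \<bar>r0\<bar>) * w t x"
proof -
  define k where "k t = \<Lambda> * (1 - exp (2 * r0 * (t - s))) / (2 * \<bar>r0\<bar>)" for t
  have k_deriv: "(k has_real_derivative \<Lambda> * exp (2 * r0 * (t - s))) (at t)" for t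
    unfolding k_def using r0 by (auto intro!: derivative_eq_intros)
  have k: "0 \<le> k t" "k t \<le> \<Lambda> / (2 * \<bar>r0\<bar>)" if "s \<le> t" for t
  proof -
    have "exp (2 * r0 * (t - s)) \<le> 1" using r0 that by (simp add: mult_nonpos_nonneg)
    then show "0 \<le> k t" using \<Lambda> by (simp add: k_def)
    have "\<Lambda> * (1 - exp (2 * r0 * (t - s))) \<le> \<Lambda> * 1" using \<Lambda> by (intro mult_left_mono) auto
    then show "k t \<le> \<Lambda> / (2 * \<bar>r0\<bar>)" unfolding k_def by (intro divide_right_mono) auto
  qed
  have h_pos: "0 < h x" for x using \<delta>(1) \<delta>(2)[of x] by linarith
  have u_pos: "0 < u t x" if "s \<le> t" for t x
    using solution_lower_bound[OF u \<delta>(2) that, of x] \<delta>(1) by linarith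
  have w_nonneg: "0 \<le> w t x" if "s \<le> t" for t x
    by (rule solution_lower_bound[OF w _ that]) (use h_pos less_imp_le in \<open>auto intro: divide_nonneg_pos\<close>)
  obtain M where M: "\<And>t x. s \<le> t \<Longrightarrow> \<bar>g t x\<bar> \<le> M" using solution_bounded[OF g] by blast
  have Z: "supersolution (\<lambda>t x. u t x * ln (u t x) + k t * w t x)"
    unfolding supersolution_def
  proof (intro conjI allI impI)
    have cu: "continuous_on ({s..} \<times> UNIV) (\<lambda>z. u (fst z) (snd z))"
      and cw: "continuous_on ({s..} \<times> UNIV) (\<lambda>z. w (fst z) (snd z))"
      using u w by (simp_all add: bounded_classical_solution_def case_prod_unfold)
    show "continuous_on ({s..} \<times> UNIV) (\<lambda>(t, x). u t x * ln (u t x) + k t * w t x)"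
      unfolding case_prod_unfold k_def
      by (intro continuous_intros cu cw) (use u_pos r0 in \<open>auto simp: less_imp_neq[symmetric]\<close>)
    fix t x assume t: "s < t"
    define p where "p = grad (u t) x"
    define H where "H = hessian (u t) x"
    define q where "q = grad (w t) x"
    define W where "W = hessian (w t) x"
    define T where "T = trace (Q t ** H) + b t x \<bullet> p"
    define S where "S = trace (Q t ** W) + b t x \<bullet> q"
    note du = solution_derivatives[OF u t, of x, folded p_def H_def, folded T_def]
    note dw = solution_derivatives[OF w t, of x, folded q_def W_def, folded S_def]
    have up: "0 < u t y" for y using u_pos t by simp
    have time: "((\<lambda>\<tau>. u \<tau> x * ln (u \<tau> x) + k \<tau> * w \<tau> x) has_real_derivative
        (ln (u t x) + 1) * T + (\<Lambda> * exp (2 * r0 * (t - s)) * w t x + k t * S)) (at t)"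
      using up[of x] by (auto intro!: derivative_eq_intros du(1) dw(1) k_deriv simp: field_simps)
    have space: "jet2 (\<lambda>y. (\<lambda>r. r * ln r) (u t y) + k t * w t y) x ((ln (u t x) + 1) *\<^sub>R p + k t *\<^sub>R q)
        (((1 / u t x) *\<^sub>R outer p + (ln (u t x) + 1) *\<^sub>R H) + k t *\<^sub>R W)"
    proof (intro jet2_add jet2_scale dw(2) jet2_compose[where \<psi>' = "\<lambda>r. ln r + 1"] du(2))
      show "((\<lambda>r. r * ln r) has_real_derivative ln (u t y) + 1) (at (u t y))" for y
        using up[of y] by (auto intro!: derivative_eq_intros)
      show "((\<lambda>r. ln r + 1) has_real_derivative 1 / u t x) (at (u t x))"
        using up[of x] by (auto intro!: derivative_eq_intros)
    qed
    have "(Q t *v p) \<bullet> p \<le> \<Lambda> * (norm p)\<^sup>2" by (rule Q_le[OF t])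
    also have "\<dots> \<le> \<Lambda> * (exp (2 * r0 * (t - s)) * (w t x * u t x))"
      unfolding p_def by (rule mult_left_mono[OF gradient_estimate[OF h \<delta> u w t] \<Lambda>])
    finally have "(Q t *v p) \<bullet> p / u t x \<le> \<Lambda> * exp (2 * r0 * (t - s)) * w t x"
      using up[of x] by (simp add: pos_divide_le_eq mult_ac)
    then have "trace (Q t ** (((1 / u t x) *\<^sub>R outer p + (ln (u t x) + 1) *\<^sub>R H) + k t *\<^sub>R W))
        + b t x \<bullet> ((ln (u t x) + 1) *\<^sub>R p + k t *\<^sub>R q)
      \<le> (ln (u t x) + 1) * T + (\<Lambda> * exp (2 * r0 * (t - s)) * w t x + k t * S)"
      unfolding trace_right_linear trace_mult_outer T_def S_def
      by (simp add: inner_add_right algebra_simps)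
    with time space show "\<exists>d p H. ((\<lambda>\<tau>. u \<tau> x * ln (u \<tau> x) + k \<tau> * w \<tau> x) has_real_derivative d) (at t) \<and>
        jet2 (\<lambda>x. u t x * ln (u t x) + k t * w t x) x p H \<and> trace (Q t ** H) + b t x \<bullet> p \<le> d"
      by blast
  qed
  have "0 \<le> (u t x * ln (u t x) + k t * w t x) + - g t x"
  proof (rule minimum_principle[OF supersolution_add[OF Z solution_supersolution(2)[OF g]] _ _ t])
    fix t x assume t: "s \<le> t"
    have "u t x * ln (u t x) \<ge> u t x - 1"
      using ln_le_minus_one[of "1 / u t x"] u_pos[OF t, of x] by (simp add: ln_div field_simps)
    moreover have "0 \<le> k t * w t x" using k(1)[OF t] w_nonneg[OF t] by simp
    ultimately show "- (M + 1) \<le> (u t x * ln (u t x) + k t * w t x) + - g t x"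
      using M[OF t, of x] u_pos[OF t, of x] by linarith
  next
    show "0 \<le> (u s x * ln (u s x) + k s * w s x) + - g s x" for x
      by (simp add: k_def solution_initial[OF u] solution_initial[OF g])
  qed
  moreover have "k t * w t x \<le> \<Lambda> / (2 * \<bar>r0\<bar>) * w t x"
    using k(2)[OF t] w_nonneg[OF t] by (rule mult_right_mono)
  ultimately show ?thesis by linarith
qed

end

section \<open>The logarithmic Sobolev inequality for functions bounded below\<close>

lemma CbD:
  assumes "f \<in> Cb"
  shows "continuous_on UNIV f" "\<exists>M. \<forall>x. \<bar>f x\<bar> \<le> M"
  using assms by (auto simp: Cb_def bounded_iff)

lemma CbI:
  assumes "continuous_on UNIV f" "\<And>x. \<bar>f x\<bar> \<le> M"
  shows "f \<in> Cb"
  using assms by (auto simp: Cb_def bounded_iff)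

lemma Cb1_imp_Cb: "f \<in> Cb1 \<Longrightarrow> f \<in> Cb"
  by (auto simp: Cb1_def Cb_def C1_def intro!: differentiable_imp_continuous_on
      simp: differentiable_on_def intro: differentiable_at_withinI)

lemma abs_mult_ln_le:
  fixes y :: real
  assumes "0 \<le> y" "y \<le> B"
  shows "\<bar>y * ln y\<bar> \<le> B\<^sup>2 + 1"
proof (cases "y = 0")
  case False
  with assms have y: "0 < y" by simp
  have "y - 1 \<le> y * ln y"
    using ln_le_minus_one[of "1 / y"] y by (simp add: ln_div field_simps)
  moreover have "y * ln y \<le> y * y" using ln_le_minus_one[OF y] y by (intro mult_left_mono) auto
  moreover have "y * y \<le> B\<^sup>2" using assms by (auto simp: power2_eq_square intro: mult_mono)
  moreover have "0 \<le> B\<^sup>2" by simp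
  ultimately show ?thesis using y by (intro abs_leI) linarith+
qed simp

text \<open>
  With \<open>m\<close> the mean of \<open>y\<close>, the linear term has integral zero, so the entropy of \<open>y\<close> is at most
  \<open>1 / m\<close> times the mean square distance from \<open>y\<close> to any reference value \<open>c\<close>.
\<close>

lemma mult_ln_le_tangent:
  fixes y m c :: real
  assumes "0 < y" "0 < m"
  shows "y * ln y \<le> m * ln m + (1 + ln m - 2 * (m - c) / m) * (y - m) + (y - c)\<^sup>2 / m"
proof -
  have "ln (y / m) \<le> y / m - 1" using assms by (intro ln_le_minus_one) simp
  then have "y * ln (y / m) \<le> y * (y / m - 1)" using assms by (intro mult_left_mono) auto
  also have "y * (y / m - 1) = (y - m) + (y - m)\<^sup>2 / m"
    using assms by (simp add: field_simps power2_eq_square)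
  finally have "y * ln y \<le> y * ln m + (y - m) + (y - m)\<^sup>2 / m"
    using assms by (simp add: ln_div right_diff_distrib)
  moreover have "(y - m)\<^sup>2 \<le> (y - c)\<^sup>2 - 2 * (m - c) * (y - m)"
    using zero_le_power2[of "m - c"] by (simp add: power2_eq_square algebra_simps)
  then have "(y - m)\<^sup>2 / m \<le> ((y - c)\<^sup>2 - 2 * (m - c) * (y - m)) / m"
    using assms by (intro divide_right_mono) auto
  then have "(y - m)\<^sup>2 / m \<le> (y - c)\<^sup>2 / m - 2 * (m - c) / m * (y - m)"
    by (simp only: diff_divide_distrib times_divide_eq_left)
  moreover define Z where "Z = 2 * (m - c) / m"
  ultimately show ?thesis
    unfolding Z_def[symmetric] by (simp add: algebra_simps)
qed


context dissipative_diffusion begin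

text \<open>
  The inequality of \<open>local_log_Sobolev\<close> is integrated against \<open>\<mu>\<^sub>t\<close>. What is left is to see that
  the entropy of \<open>u(t,\<cdot>)\<close> under \<open>\<mu>\<^sub>t\<close> becomes arbitrarily small. On a ball of radius \<open>R\<close> the
  function \<open>u(t,\<cdot>)\<close> is within \<open>R sup \<bar>\<nabla>u(t,\<cdot>)\<bar>\<close> of \<open>u(t,0)\<close>, which tends to zero by
  \<open>gradient_estimate\<close>; off the ball it is bounded and, by tightness, the mass is small uniformly in
  \<open>t\<close>.
\<close>

lemma log_Sobolev_bounded_below:
  fixes \<mu> :: "real \<Rightarrow> (real^'n) measure"
  assumes h: "h \<in> Cb1" and \<delta>: "0 < \<delta>" "\<And>x. \<delta> \<le> h x"
    and r0: "r0 < 0" and Q_le: "\<And>t \<xi>. s < t \<Longrightarrow> (Q t *v \<xi>) \<bullet> \<xi> \<le> \<Lambda> * (norm \<xi>)\<^sup>2" and \<Lambda>: "0 \<le> \<Lambda>"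
    and G: "\<And>f. f \<in> Cb \<Longrightarrow> bounded_classical_solution Q b s f (\<lambda>t. G t s f)"
    and prob: "\<And>t. s \<le> t \<Longrightarrow> prob_space (\<mu> t)" and sets: "\<And>t. s \<le> t \<Longrightarrow> sets (\<mu> t) = sets borel"
    and inv: "\<And>t f. s < t \<Longrightarrow> f \<in> Cb \<Longrightarrow> (\<integral>x. G t s f x \<partial>\<mu> t) = (\<integral>x. f x \<partial>\<mu> s)"
    and tight: "\<And>\<epsilon>. 0 < \<epsilon> \<Longrightarrow> \<exists>R>0. \<forall>t\<ge>s. measure (\<mu> t) (- ball 0 R) \<le> \<epsilon>"
  shows "(\<integral>x. h x * ln (h x) \<partial>\<mu> s) \<le> (\<integral>x. h x \<partial>\<mu> s) * ln (\<integral>x. h x \<partial>\<mu> s)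
    + \<Lambda> / (2 * \<bar>r0\<bar>) * (\<integral>x. (norm (grad h x))\<^sup>2 / h x \<partial>\<mu> s)"
proof -
  define m where "m = (\<integral>x. h x \<partial>\<mu> s)"
  define F where "F x = (norm (grad h x))\<^sup>2 / h x" for x
  define \<Phi> where "\<Phi> x = h x * ln (h x)" for x
  have hCb: "h \<in> Cb" using h by (rule Cb1_imp_Cb)
  have h_pos: "0 < h x" for x using \<delta>(1) \<delta>(2)[of x] by linarith
  obtain M0 where M0: "\<And>x. \<bar>h x\<bar> \<le> M0" using CbD(2)[OF hCb] by blast
  obtain L where L: "\<And>x. norm (grad h x) \<le> L" using Cb1_Lipschitz[OF h] by metis
  have FCb: "F \<in> Cb"
  proof (rule CbI[of _ "L\<^sup>2 / \<delta>"])
    show "continuous_on UNIV F"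
      unfolding F_def using h h_pos CbD(1)[OF hCb]
      by (intro continuous_intros) (auto simp: Cb1_def C1_def less_imp_neq[symmetric])
    show "\<bar>F x\<bar> \<le> L\<^sup>2 / \<delta>" for x
      unfolding F_def using L[of x] h_pos[of x] \<delta>(1) \<delta>(2)[of x]
      by (auto intro!: frac_le power_mono)
  qed
  have \<Phi>Cb: "\<Phi> \<in> Cb"
  proof (rule CbI)
    show "continuous_on UNIV \<Phi>"
      unfolding \<Phi>_def using h_pos CbD(1)[OF hCb]
      by (intro continuous_intros) (auto simp: less_imp_neq[symmetric])
    show "\<bar>\<Phi> x\<bar> \<le> M0\<^sup>2 + 1" for x
      unfolding \<Phi>_def using h_pos[of x] M0[of x] by (intro abs_mult_ln_le) auto
  qed
  define u where "u t = G t s h" for t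
  define w where "w t = G t s F" for t
  define g where "g t = G t s \<Phi>" for t
  have u: "bounded_classical_solution Q b s h u" unfolding u_def by (rule G[OF hCb])
  have w: "bounded_classical_solution Q b s F w" unfolding w_def by (rule G[OF FCb])
  have g: "bounded_classical_solution Q b s \<Phi> g" unfolding g_def by (rule G[OF \<Phi>Cb])
  have int: "integrable (\<mu> t) f" if "f \<in> Cb" "s \<le> t" for f t
    using Cb_integrable that prob sets by blast
  have u_pos: "0 < u t x" if "s \<le> t" for t x
    using solution_lower_bound[OF u \<delta>(2) that, of x] \<delta>(1) by linarith
  obtain M where M: "\<And>t x. s \<le> t \<Longrightarrow> \<bar>u t x\<bar> \<le> M" using solution_bounded[OF u] by blast
  obtain Mw where Mw: "\<And>t x. s \<le> t \<Longrightarrow> \<bar>w t x\<bar> \<le> Mw" using solution_bounded[OF w] by blast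
  have M_nonneg: "0 \<le> M" "0 \<le> Mw" using M[of s 0] Mw[of s 0] by linarith+
  have m: "0 < m"
  proof -
    interpret prob_space "\<mu> s" by (rule prob) simp
    have "\<delta> = (\<integral>x. \<delta> \<partial>\<mu> s)" by (simp add: prob_space)
    also have "\<dots> \<le> m" unfolding m_def by (rule integral_mono) (use int hCb \<delta>(2) in auto)
    finally show ?thesis using \<delta>(1) by simp
  qed
  have spread: "\<exists>t>s. (\<integral>x. (u t x - u t 0)\<^sup>2 \<partial>\<mu> t) \<le> \<epsilon>" if \<epsilon>: "0 < \<epsilon>" for \<epsilon>
  proof -
    obtain R where R: "0 < R" "\<And>t. s \<le> t \<Longrightarrow> measure (\<mu> t) (- ball 0 R) \<le> \<epsilon> / (8 * M\<^sup>2 + 1)"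
      using tight[of "\<epsilon> / (8 * M\<^sup>2 + 1)"] \<epsilon> by (auto simp: add_nonneg_pos)
    define B where "B = Mw * M * R\<^sup>2"
    have B: "0 \<le> B" using M_nonneg by (simp add: B_def)
    \<comment> \<open>Large enough for \<open>exp (2 r0 \<tau>) B \<le> \<epsilon> / 2\<close>, by \<open>exp z \<ge> 1 + z\<close>.\<close>
    define \<tau> where "\<tau> = B / (\<epsilon> * \<bar>r0\<bar>) + 1"
    have \<tau>: "0 < \<tau>" using B \<epsilon> by (simp add: \<tau>_def add_nonneg_pos)
    define t where "t = s + \<tau>"
    have t: "s < t" using \<tau> by (simp add: t_def)
    interpret prob_space "\<mu> t" by (rule prob) (use t in simp)
    have "exp (2 * r0 * \<tau>) * (2 * B / \<epsilon>) \<le> exp (2 * r0 * \<tau>) * exp (- (2 * r0 * \<tau>))"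
    proof (rule mult_left_mono)
      have "2 * \<bar>r0\<bar> * \<tau> = 2 * B / \<epsilon> + 2 * \<bar>r0\<bar>"
      proof -
        define \<rho> where "\<rho> = \<bar>r0\<bar>"
        have "0 < \<rho>" using r0 by (simp add: \<rho>_def)
        then show ?thesis using \<epsilon> unfolding \<tau>_def \<rho>_def[symmetric] by (simp add: field_simps)
      qed
      then have "2 * B / \<epsilon> \<le> 1 + - (2 * r0 * \<tau>)" using r0 by simp
      also have "\<dots> \<le> exp (- (2 * r0 * \<tau>))" by (rule exp_ge_add_one_self)
      finally show "2 * B / \<epsilon> \<le> exp (- (2 * r0 * \<tau>))" .
    qed simp
    then have decay: "exp (2 * r0 * \<tau>) * B \<le> \<epsilon> / 2" using \<epsilon> by (simp add: exp_minus field_simps)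
    have pointwise: "(u t x - u t 0)\<^sup>2 \<le> \<epsilon> / 2 + 4 * M\<^sup>2 * indicator (- ball 0 R) x" for x
    proof (cases "x \<in> ball 0 R")
      case True
      obtain z where z: "u t x - u t 0 = grad (u t) z \<bullet> (x - 0)"
        using mean_value_grad[of "u t" x 0] u t by (auto simp: bounded_classical_solution_def C12_def)
      have "\<bar>u t x - u t 0\<bar> \<le> norm (grad (u t) z) * norm x"
        unfolding z using Cauchy_Schwarz_ineq2[of "grad (u t) z" x] by simp
      then have "(u t x - u t 0)\<^sup>2 \<le> (norm (grad (u t) z) * norm x)\<^sup>2"
        by (metis abs_ge_zero power2_abs power_mono)
      also have "\<dots> \<le> (exp (2 * r0 * \<tau>) * (Mw * M)) * R\<^sup>2"
      proof -
        have "(norm (grad (u t) z))\<^sup>2 \<le> exp (2 * r0 * (t - s)) * (w t z * u t z)"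
          using gradient_estimate[OF h \<delta> u w[unfolded F_def] t] .
        also have "\<dots> \<le> exp (2 * r0 * \<tau>) * (Mw * M)"
          using M[of t z] Mw[of t z] u_pos[of t z] t M_nonneg
          by (auto simp: t_def intro!: mult_left_mono mult_mono)
        finally have "(norm (grad (u t) z))\<^sup>2 \<le> exp (2 * r0 * \<tau>) * (Mw * M)" .
        moreover have "(norm x)\<^sup>2 \<le> R\<^sup>2" using True by (intro power_mono) auto
        ultimately show ?thesis
          unfolding power_mult_distrib using M_nonneg by (intro mult_mono) auto
      qed
      also have "\<dots> \<le> \<epsilon> / 2" using decay by (simp add: B_def mult_ac)
      finally show ?thesis using True by simp
    next
      case False
      have "\<bar>u t x - u t 0\<bar> \<le> 2 * M" using M[of t x] M[of t 0] t by linarith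
      then have "(u t x - u t 0)\<^sup>2 \<le> (2 * M)\<^sup>2" by (metis abs_ge_zero power2_abs power_mono)
      then show ?thesis using False \<epsilon> by (simp add: power_mult_distrib)
    qed
    have ball: "- ball 0 R \<in> sets (\<mu> t)" using sets[of t] t by simp
    have ball_int: "integrable (\<mu> t) (\<lambda>x. 4 * M\<^sup>2 * indicator (- ball 0 R) x)"
      by (intro integrable_mult_right integrable_real_indicator[OF ball]) (simp add: emeasure_eq_measure)
    have uCb: "(\<lambda>x. (u t x - u t 0)\<^sup>2) \<in> Cb"
    proof (rule CbI)
      show "continuous_on UNIV (\<lambda>x. (u t x - u t 0)\<^sup>2)"
        using CbD(1)[OF solution_Cb[OF u]] t by (intro continuous_intros) auto
      show "\<bar>(u t x - u t 0)\<^sup>2\<bar> \<le> \<epsilon> / 2 + 4 * M\<^sup>2" for x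
        using order_trans[OF pointwise[of x], of "\<epsilon> / 2 + 4 * M\<^sup>2"]
        by (auto simp: indicator_def split: if_splits)
    qed
    have "(\<integral>x. (u t x - u t 0)\<^sup>2 \<partial>\<mu> t) \<le> (\<integral>x. \<epsilon> / 2 + 4 * M\<^sup>2 * indicator (- ball 0 R) x \<partial>\<mu> t)"
    proof (rule integral_mono)
      show "integrable (\<mu> t) (\<lambda>x. \<epsilon> / 2 + 4 * M\<^sup>2 * indicator (- ball 0 R) x)"
        by (intro Bochner_Integration.integrable_add integrable_const ball_int)
    qed (use int[OF uCb] t pointwise in auto)
    also have "\<dots> = \<epsilon> / 2 + 4 * M\<^sup>2 * measure (\<mu> t) (- ball 0 R)"
    proof -
      have sp: "space (\<mu> t) = UNIV" using sets_eq_imp_space_eq[OF sets[of t]] t by simp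
      then show ?thesis using prob_space
        by (subst Bochner_Integration.integral_add[OF integrable_const ball_int]) simp
    qed
    also have "\<dots> \<le> \<epsilon> / 2 + 4 * M\<^sup>2 * (\<epsilon> / (8 * M\<^sup>2 + 1))"
      using R(2)[of t] t by (intro add_left_mono mult_left_mono) auto
    also have "\<dots> \<le> \<epsilon>"
    proof -
      have "4 * M\<^sup>2 / (8 * M\<^sup>2 + 1) \<le> 1 / 2" by (simp add: divide_le_eq add_nonneg_pos)
      then have "4 * M\<^sup>2 / (8 * M\<^sup>2 + 1) * \<epsilon> \<le> 1 / 2 * \<epsilon>" using \<epsilon> by (intro mult_right_mono) auto
      moreover have "4 * M\<^sup>2 * (\<epsilon> / (8 * M\<^sup>2 + 1)) = 4 * M\<^sup>2 / (8 * M\<^sup>2 + 1) * \<epsilon>" by simp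
      ultimately show ?thesis by linarith
    qed
    finally show ?thesis using t by blast
  qed
  have "(\<integral>x. \<Phi> x \<partial>\<mu> s) - (m * ln m + \<Lambda> / (2 * \<bar>r0\<bar>) * (\<integral>x. F x \<partial>\<mu> s)) \<le> \<epsilon> * (1 / m)" if \<epsilon>: "0 < \<epsilon>" for \<epsilon>
  proof -
    obtain t where t: "s < t" and var: "(\<integral>x. (u t x - u t 0)\<^sup>2 \<partial>\<mu> t) \<le> \<epsilon>" using spread[OF \<epsilon>] by blast
    interpret prob_space "\<mu> t" by (rule prob) (use t in simp)
    have uCb: "u t \<in> Cb" and wCb: "w t \<in> Cb" and gCb: "g t \<in> Cb"
      using solution_Cb[OF u, of t] solution_Cb[OF w, of t] solution_Cb[OF g, of t] t by simp_all
    define c where "c = u t 0"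
    define \<beta> where "\<beta> = 1 + ln m - 2 * (m - c) / m"
    have sqCb: "(\<lambda>x. (u t x - c)\<^sup>2) \<in> Cb"
    proof (rule CbI)
      show "continuous_on UNIV (\<lambda>x. (u t x - c)\<^sup>2)"
        using CbD(1)[OF uCb] by (intro continuous_intros)
      have "\<bar>u t x - c\<bar> \<le> 2 * M" for x using M[of t x] M[of t 0] t by (simp add: c_def)
      then show "\<bar>(u t x - c)\<^sup>2\<bar> \<le> (2 * M)\<^sup>2" for x
        by (metis abs_ge_zero power2_abs power_mono abs_power2)
    qed
    note i = int[OF uCb] int[OF wCb] int[OF gCb] int[OF sqCb]
    have le: "g t x \<le> m * ln m + \<beta> * (u t x - m) + (u t x - c)\<^sup>2 / m + \<Lambda> / (2 * \<bar>r0\<bar>) * w t x" for x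
    proof -
      have "g t x \<le> u t x * ln (u t x) + \<Lambda> / (2 * \<bar>r0\<bar>) * w t x"
        by (rule local_log_Sobolev[OF h \<delta> r0 Q_le \<Lambda> u w[unfolded F_def] g[unfolded \<Phi>_def]]) (use t in auto)
      moreover have "u t x * ln (u t x) \<le> m * ln m + \<beta> * (u t x - m) + (u t x - c)\<^sup>2 / m"
        unfolding \<beta>_def using u_pos[of t x] m t by (intro mult_ln_le_tangent) auto
      ultimately show ?thesis by linarith
    qed
    have "(\<integral>x. \<Phi> x \<partial>\<mu> s) = (\<integral>x. g t x \<partial>\<mu> t)" unfolding g_def by (rule inv[OF t \<Phi>Cb, symmetric])
    also have "\<dots> \<le> (\<integral>x. m * ln m + \<beta> * (u t x - m) + (u t x - c)\<^sup>2 / m + \<Lambda> / (2 * \<bar>r0\<bar>) * w t x \<partial>\<mu> t)"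
      by (rule integral_mono) (use i t le in \<open>auto intro: less_imp_le\<close>)
    also have "\<dots> = m * ln m + \<beta> * ((\<integral>x. u t x \<partial>\<mu> t) - m) + (\<integral>x. (u t x - c)\<^sup>2 \<partial>\<mu> t) / m
        + \<Lambda> / (2 * \<bar>r0\<bar>) * (\<integral>x. w t x \<partial>\<mu> t)"
      using i t by (simp add: prob_space)
    also have "(\<integral>x. u t x \<partial>\<mu> t) = m" unfolding u_def m_def by (rule inv[OF t hCb])
    also have "(\<integral>x. w t x \<partial>\<mu> t) = (\<integral>x. F x \<partial>\<mu> s)" unfolding w_def by (rule inv[OF t FCb])
    finally have "(\<integral>x. \<Phi> x \<partial>\<mu> s) \<le> m * ln m + (\<integral>x. (u t x - c)\<^sup>2 \<partial>\<mu> t) / m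
        + \<Lambda> / (2 * \<bar>r0\<bar>) * (\<integral>x. F x \<partial>\<mu> s)" by simp
    moreover have "(\<integral>x. (u t x - c)\<^sup>2 \<partial>\<mu> t) / m \<le> \<epsilon> / m"
      using var m unfolding c_def by (intro divide_right_mono) auto
    ultimately show ?thesis by simp
  qed
  from le_zero_of_small_multiples[OF this]
  show ?thesis by (simp add: \<Phi>_def F_def m_def)
qed

end

section \<open>Powers of a function, and the theorem\<close>

lemma inner_diff_le_of_jacobian:
  fixes B :: "real^'n \<Rightarrow> real^'n"
  assumes B: "\<And>x. B differentiable (at x)"
    and J: "\<And>x \<xi>. (jacobian B (at x) *v \<xi>) \<bullet> \<xi> \<le> r * (norm \<xi>)\<^sup>2"
  shows "(B x - B y) \<bullet> (x - y) \<le> r * (norm (x - y))\<^sup>2"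
proof -
  define \<xi> where "\<xi> = x - y"
  have d: "((\<lambda>\<tau>. B (y + \<tau> *\<^sub>R \<xi>) \<bullet> \<xi>) has_real_derivative (jacobian B (at (y + \<tau> *\<^sub>R \<xi>)) *v \<xi>) \<bullet> \<xi>) (at \<tau>)" for \<tau>
  proof -
    have "((\<lambda>\<tau>. y + \<tau> *\<^sub>R \<xi>) has_derivative (\<lambda>h. h *\<^sub>R \<xi>)) (at \<tau>)"
      by (auto intro!: derivative_eq_intros)
    moreover have "(B has_derivative (\<lambda>h. jacobian B (at (y + \<tau> *\<^sub>R \<xi>)) *v h)) (at (y + \<tau> *\<^sub>R \<xi>))"
      by (rule jacobian_works[THEN iffD1, OF B])
    ultimately have "((\<lambda>\<tau>. B (y + \<tau> *\<^sub>R \<xi>)) has_derivative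
        (\<lambda>h. jacobian B (at (y + \<tau> *\<^sub>R \<xi>)) *v (h *\<^sub>R \<xi>))) (at \<tau>)"
      using has_derivative_compose[where f = "\<lambda>\<tau>. y + \<tau> *\<^sub>R \<xi>" and g = B and x = \<tau> and s = UNIV
          and f' = "\<lambda>h. h *\<^sub>R \<xi>" and g' = "\<lambda>h. jacobian B (at (y + \<tau> *\<^sub>R \<xi>)) *v h"] by simp
    then have "((\<lambda>\<tau>. B (y + \<tau> *\<^sub>R \<xi>) \<bullet> \<xi>) has_derivative
        (\<lambda>h. (jacobian B (at (y + \<tau> *\<^sub>R \<xi>)) *v (h *\<^sub>R \<xi>)) \<bullet> \<xi>)) (at \<tau>)"
      by (rule has_derivative_inner_left)
    then show ?thesis
      by (simp add: has_field_derivative_def matrix_vector_mult_scaleR mult_commute_abs)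
  qed
  obtain \<tau> where "B (y + 1 *\<^sub>R \<xi>) \<bullet> \<xi> - B (y + 0 *\<^sub>R \<xi>) \<bullet> \<xi> =
      (1 - 0) * ((jacobian B (at (y + \<tau> *\<^sub>R \<xi>)) *v \<xi>) \<bullet> \<xi>)"
    using MVT2[of 0 1, OF _ d] by auto
  then show ?thesis using J[of "y + \<tau> *\<^sub>R \<xi>" \<xi>] by (simp add: \<xi>_def inner_diff_left)
qed

lemma has_real_derivative_abs_powr:
  fixes p :: real
  assumes p: "1 < p"
  shows "((\<lambda>y. \<bar>y\<bar> powr p) has_real_derivative p * (\<bar>y\<bar> powr (p - 1) * sgn y)) (at y)"
proof (cases y "0 :: real" rule: linorder_cases)
  case greater
  have "((\<lambda>y. y powr p) has_real_derivative p * (\<bar>y\<bar> powr (p - 1) * sgn y)) (at y)"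
    using has_real_derivative_powr[OF greater, of p] greater by simp
  then show ?thesis
    by (rule has_field_derivative_transform_within_open[of _ _ _ "{0<..}"]) (use greater in auto)
next
  case less
  have "((\<lambda>y. (- y) powr p) has_real_derivative (p * (- y) powr (p - 1)) * (- 1)) (at y)"
    by (rule DERIV_chain2[OF has_real_derivative_powr]) (use less in \<open>auto intro!: derivative_eq_intros\<close>)
  then have "((\<lambda>y. (- y) powr p) has_real_derivative p * (\<bar>y\<bar> powr (p - 1) * sgn y)) (at y)"
    using less by simp
  then show ?thesis
    by (rule has_field_derivative_transform_within_open[of _ _ _ "{..<0}"]) (use less in auto)
next
  case equal
  have "((\<lambda>z. \<bar>z\<bar> powr p / z) \<longlongrightarrow> 0) (at (0::real))"
  proof (rule Lim_null_comparison)
    have "((\<lambda>z. \<bar>z\<bar> powr (p - 1)) \<longlongrightarrow> \<bar>0\<bar> powr (p - 1)) (at (0::real))"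
      by (rule tendsto_powr'[OF tendsto_rabs[OF tendsto_ident_at] tendsto_const]) (use p in simp)
    then show "((\<lambda>z. \<bar>z\<bar> powr (p - 1)) \<longlongrightarrow> 0) (at (0::real))" using p by simp
    show "\<forall>\<^sub>F z in at (0::real). norm (\<bar>z\<bar> powr p / z) \<le> \<bar>z\<bar> powr (p - 1)"
      by (auto simp: eventually_at_filter powr_diff)
  qed
  then show ?thesis unfolding equal by (simp add: has_field_derivative_iff)
qed

text \<open>
  Splitting into positive and negative parts reduces continuity at zero to that of powers of nonnegative
  functions.
\<close>

lemma continuous_abs_powr_sgn:
  fixes a :: real
  assumes "0 < a"
  shows "continuous_on UNIV (\<lambda>y. \<bar>y\<bar> powr a * sgn y)"
proof -
  have "(\<lambda>y. \<bar>y\<bar> powr a * sgn y) = (\<lambda>y. max y 0 powr a - max (- y) 0 powr a)"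
    by (auto simp: fun_eq_iff sgn_if max_def)
  moreover have "continuous_on UNIV (\<lambda>y::real. max y 0 powr a - max (- y) 0 powr a)"
    using assms by (intro continuous_intros continuous_on_powr') auto
  ultimately show ?thesis by (simp only:)
qed

lemma has_derivative_abs_powr:
  fixes f :: "real^'n \<Rightarrow> real"
  assumes f: "f differentiable (at x)" and p: "1 < p"
  shows "((\<lambda>y. \<delta> + \<bar>f y\<bar> powr p) has_derivative
      (\<lambda>\<sigma>. ((p * (\<bar>f x\<bar> powr (p - 1) * sgn (f x))) *\<^sub>R grad f x) \<bullet> \<sigma>)) (at x)"
proof -
  have "((\<lambda>y. \<bar>f y\<bar> powr p) has_derivative
      (\<lambda>\<sigma>. (p * (\<bar>f x\<bar> powr (p - 1) * sgn (f x))) * (grad f x \<bullet> \<sigma>))) (at x)"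
    by (rule has_derivative_compose[OF has_derivative_grad[OF f], of "\<lambda>y. \<bar>y\<bar> powr p"])
      (use has_real_derivative_abs_powr[OF p, of "f x"] in \<open>simp add: has_field_derivative_def\<close>)
  from has_derivative_add[OF has_derivative_const[of \<delta>] this] show ?thesis by simp
qed

lemma Cb1_abs_powr:
  assumes f: "f \<in> Cb1" and p: "1 < p"
  shows "(\<lambda>y. \<delta> + \<bar>f y\<bar> powr p) \<in> Cb1"
    and "grad (\<lambda>y. \<delta> + \<bar>f y\<bar> powr p) x = (p * (\<bar>f x\<bar> powr (p - 1) * sgn (f x))) *\<^sub>R grad f x"
proof -
  have diff: "f differentiable (at x)" for x using f by (simp add: Cb1_def C1_def)
  note d = has_derivative_abs_powr[OF diff p, of \<delta>]
  show g: "grad (\<lambda>y. \<delta> + \<bar>f y\<bar> powr p) x = (p * (\<bar>f x\<bar> powr (p - 1) * sgn (f x))) *\<^sub>R grad f x" for x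
    by (rule grad_eqI[OF d])
  have fc: "continuous_on UNIV f" using Cb1_imp_Cb[OF f] by (rule CbD)
  obtain M where M: "\<And>x. \<bar>f x\<bar> \<le> M" using CbD(2)[OF Cb1_imp_Cb[OF f]] by blast
  obtain L where L: "\<And>x. norm (grad f x) \<le> L" using Cb1_Lipschitz[OF f] by metis
  have "(\<lambda>y. \<delta> + \<bar>f y\<bar> powr p) differentiable (at x)" for x
    using d by (rule differentiableI)
  moreover have "continuous_on UNIV (grad (\<lambda>y. \<delta> + \<bar>f y\<bar> powr p))"
    unfolding g[abs_def] using f p
    by (intro continuous_intros continuous_on_compose2[OF continuous_abs_powr_sgn _ _, of "p - 1" UNIV f] fc)
      (auto simp: Cb1_def C1_def)
  moreover have "\<bar>f x\<bar> powr p \<le> M powr p" for x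
    using M[of x] p by (intro powr_mono2) auto
  then have "bounded (range (\<lambda>y. \<delta> + \<bar>f y\<bar> powr p))"
    unfolding bounded_iff by (intro exI[of _ "\<bar>\<delta>\<bar> + M powr p"]) (auto intro!: order_trans[OF abs_triangle_ineq])
  moreover have "norm (grad (\<lambda>y. \<delta> + \<bar>f y\<bar> powr p) x) \<le> p * M powr (p - 1) * L" for x
  proof -
    have "\<bar>f x\<bar> powr (p - 1) * \<bar>sgn (f x)\<bar> \<le> M powr (p - 1) * 1"
      using M[of x] p by (intro mult_mono powr_mono2) (auto simp: sgn_if)
    then have "(\<bar>f x\<bar> powr (p - 1) * \<bar>sgn (f x)\<bar>) * norm (grad f x) \<le> M powr (p - 1) * L"
      using L[of x] by (intro mult_mono) auto
    then have "p * ((\<bar>f x\<bar> powr (p - 1) * \<bar>sgn (f x)\<bar>) * norm (grad f x)) \<le> p * (M powr (p - 1) * L)"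
      using p by (intro mult_left_mono) auto
    then show ?thesis unfolding g using p by (simp add: abs_mult mult_ac)
  qed
  then have "bounded (range (grad (\<lambda>y. \<delta> + \<bar>f y\<bar> powr p)))" unfolding bounded_iff by blast
  ultimately show "(\<lambda>y. \<delta> + \<bar>f y\<bar> powr p) \<in> Cb1" by (simp add: Cb1_def C1_def)
qed

text \<open>
  The integrand \<open>\<bar>\<nabla>h\<bar>\<^sup>2 / h\<close> of \<open>h = \<delta> + \<bar>f\<bar> powr p\<close>, for \<open>y = f(x)\<close> and \<open>v = \<nabla>f(x)\<close>. Adding
  \<open>\<delta>\<close> increases only the denominator, so the bound is independent of \<open>\<delta>\<close>, also for \<open>p < 2\<close>,
  where the right-hand side is singular at the zeros of \<open>f\<close>.
\<close>

lemma fisher_abs_powr_le: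
  assumes p: "1 < p" and \<delta>: "0 < \<delta>"
  shows "(norm ((p * (\<bar>y\<bar> powr (p - 1) * sgn y)) *\<^sub>R v))\<^sup>2 / (\<delta> + \<bar>y\<bar> powr p)
    \<le> p\<^sup>2 * (\<bar>y\<bar> powr (p - 2) * (norm v)\<^sup>2 * indicator {y. y \<noteq> 0} y)"
proof (cases "y = 0")
  case False
  then have y: "0 < \<bar>y\<bar>" by simp
  have "(\<bar>y\<bar> powr (p - 1))\<^sup>2 = \<bar>y\<bar> powr (p - 2) * \<bar>y\<bar> powr p"
    by (simp add: power2_eq_square flip: powr_add)
  moreover have "(sgn y)\<^sup>2 = 1" using False by (simp add: sgn_if power2_eq_square)
  ultimately have "(norm ((p * (\<bar>y\<bar> powr (p - 1) * sgn y)) *\<^sub>R v))\<^sup>2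
      = p\<^sup>2 * (\<bar>y\<bar> powr (p - 2) * (norm v)\<^sup>2) * \<bar>y\<bar> powr p"
    by (simp add: power_mult_distrib)
  also have "\<dots> \<le> p\<^sup>2 * (\<bar>y\<bar> powr (p - 2) * (norm v)\<^sup>2) * (\<delta> + \<bar>y\<bar> powr p)"
    using \<delta> by (intro mult_left_mono) auto
  finally show ?thesis using False \<delta> by (simp add: pos_divide_le_eq add_pos_nonneg)
qed simp

text \<open>
  Passage to the limit \<open>\<delta> \<rightarrow> 0\<close>. For \<open>m > 0\<close> it suffices that \<open>\<delta> ln \<delta>\<close> is at least
  \<open>- 2 sqrt \<delta>\<close>; for \<open>m = 0\<close> the two entropy terms cancel.
\<close>

lemma entropy_limit:
  fixes A m D :: real
  assumes m: "0 \<le> m" and *: "\<And>\<delta>. 0 < \<delta> \<Longrightarrow> A + \<delta> * ln \<delta> \<le> (m + \<delta>) * ln (m + \<delta>) + D"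
  shows "A \<le> m * ln m + D"
proof (cases "m = 0")
  case True
  then show ?thesis using *[of 1] by simp
next
  case False
  with m have m: "0 < m" by simp
  have bound: "A \<le> (m + \<delta>) * ln (m + \<delta>) + D + 2 * sqrt \<delta>" if "0 < \<delta>" for \<delta>
  proof -
    have "ln (1 / sqrt \<delta>) \<le> 1 / sqrt \<delta>" using ln_le_minus_one[of "1 / sqrt \<delta>"] that by simp
    then have "- (ln \<delta> / 2) \<le> 1 / sqrt \<delta>" using that by (simp add: ln_div ln_sqrt)
    then have "\<delta> * (- (ln \<delta> / 2)) \<le> \<delta> * (1 / sqrt \<delta>)" using that by (intro mult_left_mono) auto
    also have "\<delta> * (1 / sqrt \<delta>) = sqrt \<delta>" using that by (simp add: real_div_sqrt)
    finally show ?thesis using *[OF that] by linarith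
  qed
  have "((\<lambda>\<delta>. (m + \<delta>) * ln (m + \<delta>) + D + 2 * sqrt \<delta>) \<longlongrightarrow> (m + 0) * ln (m + 0) + D + 2 * sqrt 0) (at_right 0)"
    using m by (intro tendsto_intros) auto
  then have "A \<le> (m + 0) * ln (m + 0) + D + 2 * sqrt 0"
    by (rule tendsto_lowerbound) (use bound in \<open>auto simp: eventually_at_right_less eventually_at_filter\<close>)
  then show ?thesis by simp
qed

theorem theorem3p3:
  fixes I :: "real set" and t0 :: real
    and Q :: "real \<Rightarrow> real^'n^'n"
    and b :: "real \<Rightarrow> real^'n \<Rightarrow> real^'n"
    and \<alpha> \<eta>0 \<Lambda> a c r0 :: real
    and \<phi> :: "real^'n \<Rightarrow> real"
    and G :: "real \<Rightarrow> real \<Rightarrow> (real^'n \<Rightarrow> real) \<Rightarrow> real^'n \<Rightarrow> real"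
    and \<mu> :: "real \<Rightarrow> (real^'n) measure"
    and f :: "real^'n \<Rightarrow> real"
    and p s :: real
  assumes I: "I = {t0<..}"
    and alpha: "0 < \<alpha>" "\<alpha> < 1"
    and Q_holder: "\<forall>i j. holder_loc (\<alpha> / 2) I (\<lambda>t. Q t $ i $ j)"
    and b_holder: "\<forall>i. parabolic_holder_loc \<alpha> I (\<lambda>t x. b t x $ i)"
    and Q_sym: "\<forall>t\<in>I. transpose (Q t) = Q t"
    and ellipticity_constants: "0 < \<eta>0" "\<eta>0 < \<Lambda>"
    and Q_elliptic: "\<forall>t\<in>I. \<forall>\<xi>. \<eta>0 * (norm \<xi>)\<^sup>2 \<le> (Q t *v \<xi>) \<bullet> \<xi> \<and> (Q t *v \<xi>) \<bullet> \<xi> \<le> \<Lambda> * (norm \<xi>)\<^sup>2"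
    and phi: "C2 \<phi>" "\<forall>x. 0 < \<phi> x" "filterlim \<phi> at_top at_infinity"
    and lyapunov_constants: "0 < a" "0 < c"
    and lyapunov: "\<forall>t\<in>I. \<forall>x. kolmogorov_op Q b t \<phi> x \<le> a - c * \<phi> x"
    and b_diff: "\<forall>t\<in>I. \<forall>x. b t differentiable (at x)"
    and Db_holder: "\<forall>i j. parabolic_holder_loc \<alpha> I (\<lambda>t x. jacobian (b t) (at x) $ i $ j)"
    and r0: "r0 < 0"
    and dissipative: "\<forall>t\<in>I. \<forall>x \<xi>. (jacobian (b t) (at x) *v \<xi>) \<bullet> \<xi> \<le> r0 * (norm \<xi>)\<^sup>2"
    and G: "evolution_operator I Q b G"
    and mu: "evolution_system_of_measures I G \<mu>" "tight_family I \<mu>"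
    and f: "f \<in> Cb1"
    and p: "1 < p"
    and s: "s \<in> I"
  shows "ereal (\<integral>x. \<bar>f x\<bar> powr p * ln \<bar>f x\<bar> \<partial>\<mu> s)
    \<le> ereal (1 / p * (\<integral>x. \<bar>f x\<bar> powr p \<partial>\<mu> s) * ln (\<integral>x. \<bar>f x\<bar> powr p \<partial>\<mu> s))
      + ereal (p * \<Lambda> / (2 * \<bar>r0\<bar>)) *
        enn2ereal (\<integral>\<^sup>+x. ennreal (\<bar>f x\<bar> powr (p - 2) * (norm (grad f x))\<^sup>2 * indicator {y. f y \<noteq> 0} x) \<partial>\<mu> s)"
proof -
  have s': "t \<in> I" if "s \<le> t" for t using s that by (simp add: I)
  interpret dissipative_diffusion s Q b \<phi> a r0
  proof
    fix t :: real assume "s < t"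
    then have t: "t \<in> I" using s' by simp
    show "transpose (Q t) = Q t" using Q_sym t by blast
    show "0 \<le> (Q t *v \<xi>) \<bullet> \<xi>" for \<xi>
    proof -
      have "0 \<le> \<eta>0 * (norm \<xi>)\<^sup>2" using ellipticity_constants by simp
      also have "\<dots> \<le> (Q t *v \<xi>) \<bullet> \<xi>" using Q_elliptic t by blast
      finally show ?thesis .
    qed
    show "trace (Q t ** hessian \<phi> x) + b t x \<bullet> grad \<phi> x \<le> a" for x
    proof -
      have "kolmogorov_op Q b t \<phi> x \<le> a - c * \<phi> x" using lyapunov t by blast
      moreover have "0 < c * \<phi> x" using lyapunov_constants phi(2) by simp
      ultimately show ?thesis by (simp add: kolmogorov_op_def)
    qed
    show "(b t x - b t y) \<bullet> (x - y) \<le> r0 * (norm (x - y))\<^sup>2" for x y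
      by (rule inner_diff_le_of_jacobian) (use b_diff dissipative t in blast)+
  qed (use phi lyapunov_constants in auto)
  have \<Lambda>: "0 < \<Lambda>" using ellipticity_constants by simp
  define \<kappa> where "\<kappa> = \<Lambda> / (2 * \<bar>r0\<bar>)"
  have \<kappa>: "0 < \<kappa>" unfolding \<kappa>_def using \<Lambda> r0 by (intro divide_pos_pos) auto
  have p0: "0 < p" using p by simp
  interpret prob_space "\<mu> s"
    using mu(1) s by (simp add: evolution_system_of_measures_def)
  have sets_s: "sets (\<mu> s) = sets borel"
    using mu(1) s by (simp add: evolution_system_of_measures_def)
  define m where "m = (\<integral>x. \<bar>f x\<bar> powr p \<partial>\<mu> s)"
  define A where "A = (\<integral>x. \<bar>f x\<bar> powr p * ln (\<bar>f x\<bar> powr p) \<partial>\<mu> s)"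
  define X where "X x = \<bar>f x\<bar> powr (p - 2) * (norm (grad f x))\<^sup>2 * indicator {y. f y \<noteq> 0} x" for x
  define J where "J = (\<integral>\<^sup>+x. ennreal (X x) \<partial>\<mu> s)"
  have A_eq: "A = p * (\<integral>x. \<bar>f x\<bar> powr p * ln \<bar>f x\<bar> \<partial>\<mu> s)"
  proof -
    have "\<bar>f x\<bar> powr p * ln (\<bar>f x\<bar> powr p) = p * (\<bar>f x\<bar> powr p * ln \<bar>f x\<bar>)" for x
      by (simp add: ln_powr)
    then show ?thesis unfolding A_def by (simp only: integral_mult_right_zero)
  qed
  have m: "0 \<le> m" unfolding m_def by (rule Bochner_Integration.integral_nonneg) simp
  obtain M where M: "\<And>x. \<bar>f x\<bar> \<le> M" using CbD(2)[OF Cb1_imp_Cb[OF f]] by blast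
  have gM: "\<bar>f x\<bar> powr p \<le> M powr p" for x using M[of x] p0 by (intro powr_mono2) auto
  have shift: "(\<lambda>x. \<delta> + \<bar>f x\<bar> powr p) \<in> Cb" for \<delta> using Cb1_imp_Cb[OF Cb1_abs_powr(1)[OF f p]] .
  have int_g: "integrable (\<mu> s) (\<lambda>x. \<bar>f x\<bar> powr p)"
    using Cb_integrable[OF shift[of 0] prob_space_axioms sets_s] by simp
  have meas: "(\<lambda>x. \<bar>f x\<bar> powr p) \<in> borel_measurable (\<mu> s)" using int_g by simp
  have int_ln: "integrable (\<mu> s) (\<lambda>x. (\<delta> + \<bar>f x\<bar> powr p) * ln (\<delta> + \<bar>f x\<bar> powr p))" if "0 \<le> \<delta>" for \<delta>
  proof (rule integrable_const_bound)
    show "AE x in \<mu> s. norm ((\<delta> + \<bar>f x\<bar> powr p) * ln (\<delta> + \<bar>f x\<bar> powr p)) \<le> (\<delta> + M powr p)\<^sup>2 + 1"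
      unfolding real_norm_def using that gM by (intro AE_I2 abs_mult_ln_le) auto
  qed (use meas in measurable)
  have main: "A \<le> m * ln m + \<kappa> * (p\<^sup>2 * j)" if j: "J \<le> ennreal j" "0 \<le> j" for j
  proof (rule entropy_limit[OF m])
    fix \<delta> :: real assume \<delta>: "0 < \<delta>"
    define h where "h x = \<delta> + \<bar>f x\<bar> powr p" for x
    have h: "h \<in> Cb1" unfolding h_def by (rule Cb1_abs_powr(1)[OF f p])
    define F where "F x = (norm (grad h x))\<^sup>2 / h x" for x
    have F: "0 \<le> F x" "F x / p\<^sup>2 \<le> X x" for x
    proof -
      show "0 \<le> F x" using \<delta> by (simp add: F_def h_def add_pos_nonneg)
      have "F x \<le> p\<^sup>2 * X x"
        using fisher_abs_powr_le[OF p \<delta>, of "f x" "grad f x"] Cb1_abs_powr(2)[OF f p, of \<delta> x]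
        by (simp add: F_def X_def h_def[abs_def] indicator_def)
      then show "F x / p\<^sup>2 \<le> X x" using p0 by (simp add: divide_le_eq mult.commute)
    qed
    have F_le: "(\<integral>x. F x \<partial>\<mu> s) \<le> p\<^sup>2 * j"
    proof (cases "integrable (\<mu> s) F")
      case True
      then have "ennreal ((\<integral>x. F x / p\<^sup>2 \<partial>\<mu> s)) = (\<integral>\<^sup>+x. ennreal (F x / p\<^sup>2) \<partial>\<mu> s)"
        using F(1) by (intro nn_integral_eq_integral[symmetric]) auto
      also have "\<dots> \<le> J" unfolding J_def using F(2) by (intro nn_integral_mono ennreal_leI)
      also have "\<dots> \<le> ennreal j" by (rule j)
      finally have "(\<integral>x. F x \<partial>\<mu> s) / p\<^sup>2 \<le> j" using j(2) by simp
      then show ?thesis using p0 by (simp add: divide_le_eq mult.commute)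
    qed (use j(2) in \<open>simp add: not_integrable_integral_eq\<close>)
    \<comment> \<open>Superadditivity of \<open>y ln y\<close> on the nonnegative reals replaces a limit of integrals on the left.\<close>
    have "(\<integral>x. \<bar>f x\<bar> powr p * ln (\<bar>f x\<bar> powr p) + \<delta> * ln \<delta> \<partial>\<mu> s) \<le> (\<integral>x. h x * ln (h x) \<partial>\<mu> s)"
    proof (rule integral_mono)
      show "integrable (\<mu> s) (\<lambda>x. \<bar>f x\<bar> powr p * ln (\<bar>f x\<bar> powr p) + \<delta> * ln \<delta>)"
        using int_ln[of 0] by simp
      show "integrable (\<mu> s) (\<lambda>x. h x * ln (h x))" unfolding h_def using int_ln \<delta> by simp
      fix x
      define y where "y = \<bar>f x\<bar> powr p"
      have y: "0 \<le> y" by (simp add: y_def)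
      have "y * ln y \<le> y * ln (\<delta> + y)"
        using y \<delta> by (cases "y = 0") (auto intro!: mult_left_mono)
      moreover have "\<delta> * ln \<delta> \<le> \<delta> * ln (\<delta> + y)" using y \<delta> by (intro mult_left_mono) auto
      ultimately show "\<bar>f x\<bar> powr p * ln (\<bar>f x\<bar> powr p) + \<delta> * ln \<delta> \<le> h x * ln (h x)"
        by (simp add: h_def y_def[symmetric] distrib_right)
    qed
    moreover have "(\<integral>x. \<bar>f x\<bar> powr p * ln (\<bar>f x\<bar> powr p) + \<delta> * ln \<delta> \<partial>\<mu> s) = A + \<delta> * ln \<delta>"
      using int_ln[of 0] by (simp add: A_def prob_space)
    moreover have "(\<integral>x. h x * ln (h x) \<partial>\<mu> s) \<le> (\<integral>x. h x \<partial>\<mu> s) * ln (\<integral>x. h x \<partial>\<mu> s)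
        + \<kappa> * (\<integral>x. F x \<partial>\<mu> s)"
      unfolding \<kappa>_def F_def
    proof (rule log_Sobolev_bounded_below[OF h \<delta> _ r0])
      show "\<delta> \<le> h x" for x by (simp add: h_def)
      show "(Q t *v \<xi>) \<bullet> \<xi> \<le> \<Lambda> * (norm \<xi>)\<^sup>2" if "s < t" for t \<xi>
        using Q_elliptic s'[of t] that by simp
      show "0 \<le> \<Lambda>" using \<Lambda> by simp
      show "bounded_classical_solution Q b s f (\<lambda>t. G t s f)" if "f \<in> Cb" for f
        using G s that by (simp add: evolution_operator_def)
      show "prob_space (\<mu> t)" "sets (\<mu> t) = sets borel" if "s \<le> t" for t
        using mu(1) s'[OF that] by (simp_all add: evolution_system_of_measures_def)
      show "(\<integral>x. G t s f x \<partial>\<mu> t) = (\<integral>x. f x \<partial>\<mu> s)" if "s < t" "f \<in> Cb" for t f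
        using mu(1) s s'[of t] that by (simp add: evolution_system_of_measures_def)
      show "\<exists>R>0. \<forall>t\<ge>s. measure (\<mu> t) (- ball 0 R) \<le> \<epsilon>" if "0 < \<epsilon>" for \<epsilon>
        using mu(2) s' that unfolding tight_family_def by meson
    qed
    moreover have "(\<integral>x. h x \<partial>\<mu> s) = m + \<delta>"
      using int_g by (simp add: h_def m_def prob_space)
    moreover have "\<kappa> * (\<integral>x. F x \<partial>\<mu> s) \<le> \<kappa> * (p\<^sup>2 * j)"
      using F_le \<kappa> by (intro mult_left_mono) auto
    ultimately show "A + \<delta> * ln \<delta> \<le> (m + \<delta>) * ln (m + \<delta>) + \<kappa> * (p\<^sup>2 * j)" by simp
  qed
  have coeff: "p * \<Lambda> / (2 * \<bar>r0\<bar>) = p * \<kappa>" by (simp add: \<kappa>_def)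
  have "ereal (A / p) \<le> ereal (1 / p * m * ln m) + ereal (p * \<kappa>) * enn2ereal J"
  proof (cases J)
    case (real j)
    have "A / p \<le> (m * ln m + \<kappa> * (p\<^sup>2 * j)) / p"
      using main[of j] real p0 by (intro divide_right_mono) auto
    also have "\<dots> = 1 / p * m * ln m + p * \<kappa> * j"
      using p0 by (simp add: field_simps power2_eq_square)
    finally show ?thesis using real by (simp add: enn2ereal_ennreal)
  next
    case top
    then show ?thesis using \<kappa> p0 by (simp add: ereal_mult_eq_PInfty)
  qed
  moreover have "A / p = (\<integral>x. \<bar>f x\<bar> powr p * ln \<bar>f x\<bar> \<partial>\<mu> s)" using p0 by (simp add: A_eq)
  ultimately show ?thesis unfolding coeff J_def X_def m_def by simp
qed

end
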